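(* Let $n\ge 3$, let $b_1,\dots,b_n\in\mathbb{R}$, and for each $i\in[n]=\{1,\dots,n\}$ realize $\mathfrak{su}(1,1)$ by the differential operators $$J_{+,i}=\frac{y_i^2}{2},\qquad J_{-,i}=\frac12\left(\partial_i^2+\frac{b_i}{y_i^2}\right),\qquad J_{0,i}=\frac14\left(2y_i\partial_i+1\right),\qquad \partial_i=\partial_{y_i}.$$ For nonempty $K\subset[n]$ let $C_K=J_{0,K}^2-J_{0,K}-J_{+,K}J_{-,K}$, where $J_{\epsilon,K}=\sum_{k\in K}J_{\epsilon,k}$ for $\epsilon\in\{+,-,0\}$. Let $$\mathcal{H}=\Delta_{LB}+\sum_{i=1}^n\frac{b_i}{y_i^2},\qquad \Delta_{LB}=\sum_{1\le i<j\le n}(y_i\partial_j-y_j\partial_i)^2,$$ be the Hamiltonian of the generic superintegrable system on the sphere $\mathbb{S}^{n-1}=\{y\in\mathbb{R}^n: \sum_i y_i^2=1\}$. Then, on the sphere $\mathbb{S}^{n-1}$ (i.e. using $\sum_i y_i^2=1$), $$C_{[n]}=-\frac14\,\mathcal{H}+\frac{n^2-4n}{16},$$ and every operator $C_K$, $\emptyset\ne K\subset[n]$, commutes with $\mathcal{H}$; that is, the realization of the higher rank Racah algebra $\mathcal{R}_n$ generated by the operators $C_K$ is an algebra of symmetries of $\mathcal{H}$.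
   Context: $\mathfrak{su}(1,1)$ is the Lie algebra with generators $J_+,J_-,J_0$ and relations $[J_0,J_\pm]=\pm J_\pm$, $[J_-,J_+]=2J_0$, with Casimir $C=J_0^2-J_0-J_+J_-$ in its universal enveloping algebra. In $\mathcal{U}(\mathfrak{su}(1,1))^{\otimes n}$, $J_{\epsilon,k}$ denotes $J_\epsilon$ placed in the $k$-th tensor factor with $1$ in the other factors. The higher rank Racah algebra $\mathcal{R}_n$ (of rank $n-2$) is the subalgebra of $\mathcal{U}(\mathfrak{su}(1,1))^{\otimes n}$ generated by the elements $C_K=J_{0,K}^2-J_{0,K}-J_{+,K}J_{-,K}$ with $\emptyset\neq K\subset[n]$; here it is realized by differential operators. All operators act on smooth functions on the region where every $y_i\neq 0$. The operators $C_K$ are combinations of constants, the squared angular momentum operators $(y_i\partial_j-y_j\partial_i)^2$ and multiplication by functions of the ratios $y_j^2/y_i^2$, so they, like $\mathcal{H}$, restrict to operators on functions on (the open subset $\{y_i\ne 0 \ \forall i\}$ of) the sphere $\mathbb{S}^{n-1}$. *)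

theory Defs
  imports "HOL-Analysis.Analysis"
begin

text \<open>
  The index set \<open>[n]\<close> is a finite linearly ordered type \<open>'n\<close>, so \<open>n = CARD('n)\<close>.
  Operators act on complex-valued functions of \<open>y :: real ^ 'n\<close>; functions are total, but only
  smooth functions on the open set \<open>regular_region\<close> and their values at points of that set
  are ever considered.
\<close>

type_synonym 'n diffop = "(real ^ 'n \<Rightarrow> complex) \<Rightarrow> (real ^ 'n \<Rightarrow> complex)"

definition regular_region :: "(real ^ 'n) set" where
  "regular_region = {y. \<forall>i. y $ i \<noteq> 0}"

definition regular_sphere :: "(real ^ 'n) set" where
  "regular_sphere = sphere 0 1 \<inter> regular_region"

definition partial :: "'n \<Rightarrow> 'n::finite diffop" where
  "partial i f y = frechet_derivative f (at y) (axis i 1)"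

text \<open>On an open set \<open>U\<close>, \<open>Ck_on k U f\<close> says that \<open>f\<close> is of class \<open>C\<^sup>k\<close> on \<open>U\<close>.\<close>

primrec Ck_on :: "nat \<Rightarrow> (real ^ 'n::finite) set \<Rightarrow> (real ^ 'n \<Rightarrow> complex) \<Rightarrow> bool" where
  "Ck_on 0 U f \<longleftrightarrow> continuous_on U f"
| "Ck_on (Suc k) U f \<longleftrightarrow> f differentiable_on U \<and> (\<forall>i. Ck_on k U (partial i f))"

definition smooth :: "(real ^ 'n::finite \<Rightarrow> complex) \<Rightarrow> bool" where
  "smooth f \<longleftrightarrow> (\<forall>k. Ck_on k regular_region f)"

definition preserves_smooth :: "'n::finite diffop \<Rightarrow> bool" where
  "preserves_smooth A \<longleftrightarrow> (\<forall>f. smooth f \<longrightarrow> smooth (A f))"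

definition op_eq_on :: "(real ^ 'n::finite) set \<Rightarrow> 'n diffop \<Rightarrow> 'n diffop \<Rightarrow> bool" where
  "op_eq_on Y A B \<longleftrightarrow> (\<forall>f. smooth f \<longrightarrow> (\<forall>y\<in>Y. A f y = B f y))"

text \<open>
  \<open>A\<close> induces an operator on smooth functions on \<open>regular_sphere\<close>: the values of \<open>A f\<close> there
  depend only on the values of \<open>f\<close> there. Every smooth function on \<open>regular_sphere\<close> extends to
  a smooth function on \<open>regular_region\<close> (homogeneously of degree 0), so for operators with this
  property \<open>op_eq_on regular_sphere\<close> is equality of the induced operators, and composition of
  operators induces composition on the sphere.
\<close>

definition restricts_to_sphere :: "'n::finite diffop \<Rightarrow> bool" where
  "restricts_to_sphere A \<longleftrightarrow> preserves_smooth A \<and>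
    (\<forall>f g. smooth f \<longrightarrow> smooth g \<longrightarrow> (\<forall>y\<in>regular_sphere. f y = g y) \<longrightarrow>
       (\<forall>y\<in>regular_sphere. A f y = A g y))"

definition commutator :: "'n diffop \<Rightarrow> 'n diffop \<Rightarrow> 'n diffop" where
  "commutator A B f y = A (B f) y - B (A f) y"

definition Jplus :: "'n \<Rightarrow> 'n::finite diffop" where
  "Jplus i f y = ((y $ i)\<^sup>2 / 2) *\<^sub>R f y"

definition Jminus :: "('n \<Rightarrow> real) \<Rightarrow> 'n \<Rightarrow> 'n::finite diffop" where
  "Jminus b i f y = (1/2) *\<^sub>R (partial i (partial i f) y + (b i / (y $ i)\<^sup>2) *\<^sub>R f y)"

definition Jzero :: "'n \<Rightarrow> 'n::finite diffop" where
  "Jzero i f y = (1/4) *\<^sub>R ((2 * y $ i) *\<^sub>R partial i f y + f y)"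

text \<open>
  Commuting copies of \<open>su(1,1)\<close>, one for each index, i.e. the relations of the generators of
  the tensor power of the universal enveloping algebra.
\<close>

definition su11_realization ::
    "('n \<Rightarrow> 'n diffop) \<Rightarrow> ('n \<Rightarrow> 'n diffop) \<Rightarrow> ('n \<Rightarrow> 'n::finite diffop) \<Rightarrow> bool" where
  "su11_realization Jp Jm Jz \<longleftrightarrow>
    (\<forall>i. preserves_smooth (Jp i) \<and> preserves_smooth (Jm i) \<and> preserves_smooth (Jz i)) \<and>
    (\<forall>i. op_eq_on regular_region (commutator (Jz i) (Jp i)) (Jp i) \<and>
         op_eq_on regular_region (commutator (Jz i) (Jm i)) (\<lambda>f y. - Jm i f y) \<and>
         op_eq_on regular_region (commutator (Jm i) (Jp i)) (\<lambda>f y. 2 * Jz i f y)) \<and>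
    (\<forall>i j. i \<noteq> j \<longrightarrow>
       (\<forall>A\<in>{Jp i, Jm i, Jz i}. \<forall>B\<in>{Jp j, Jm j, Jz j}.
          op_eq_on regular_region (commutator A B) (\<lambda>f y. 0)))"

definition op_sum :: "('n \<Rightarrow> 'n diffop) \<Rightarrow> 'n set \<Rightarrow> 'n diffop" where
  "op_sum A K f y = (\<Sum>k\<in>K. A k f y)"

definition casimir :: "('n \<Rightarrow> real) \<Rightarrow> 'n set \<Rightarrow> 'n::finite diffop" where
  "casimir b K f y =
     op_sum Jzero K (op_sum Jzero K f) y - op_sum Jzero K f y
       - op_sum Jplus K (op_sum (Jminus b) K f) y"

definition angular :: "'n \<Rightarrow> 'n \<Rightarrow> 'n::finite diffop" where
  "angular i j f y = (y $ i) *\<^sub>R partial j f y - (y $ j) *\<^sub>R partial i f y"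

definition laplace_beltrami :: "'n::{finite,linorder} diffop" where
  "laplace_beltrami f y = (\<Sum>i\<in>UNIV. \<Sum>j\<in>{i<..}. angular i j (angular i j f) y)"

definition hamiltonian :: "('n \<Rightarrow> real) \<Rightarrow> 'n::{finite,linorder} diffop" where
  "hamiltonian b f y = laplace_beltrami f y + (\<Sum>i\<in>UNIV. b i / (y $ i)\<^sup>2) *\<^sub>R f y"

text \<open>The unital algebra of operators generated by the \<open>C\<^sub>K\<close> for nonempty \<open>K\<close>.\<close>

inductive_set racah_algebra :: "('n \<Rightarrow> real) \<Rightarrow> 'n::finite diffop set"
  for b :: "'n \<Rightarrow> real" where
  one: "(\<lambda>f. f) \<in> racah_algebra b"
| gen: "K \<noteq> {} \<Longrightarrow> casimir b K \<in> racah_algebra b"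
| scale: "A \<in> racah_algebra b \<Longrightarrow> (\<lambda>f y. c * A f y) \<in> racah_algebra b"
| add: "A \<in> racah_algebra b \<Longrightarrow> B \<in> racah_algebra b \<Longrightarrow>
    (\<lambda>f y. A f y + B f y) \<in> racah_algebra b"
| mult: "A \<in> racah_algebra b \<Longrightarrow> B \<in> racah_algebra b \<Longrightarrow> A \<circ> B \<in> racah_algebra b"

end

theory Submission
  imports Defs
begin

text \<open>
  Why the theorem is true. Over all indices \<open>i\<close> the operators \<open>J\<close> generate commuting copies of
  \<open>su(1,1)\<close>. If \<open>K \<subseteq> L\<close>, then \<open>C\<^sub>K\<close> commutes with the total generators
  \<open>J\<^bsub>\<epsilon>,L\<^esub> = J\<^bsub>\<epsilon>,K\<^esub> + J\<^bsub>\<epsilon>,L-K\<^esub>\<close>: with the first summand since \<open>C\<^sub>K\<close> is the Casimir element of that copy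
  of \<open>su(1,1)\<close>, and with the second since disjoint indices commute. Hence \<open>C\<^sub>K\<close> commutes with
  \<open>C\<^sub>L\<close>, in particular with \<open>C\<^bsub>[n]\<^esub>\<close> (lemma \<open>casimir_element_commute\<close>).

  It remains to recognise \<open>C\<^bsub>[n]\<^esub>\<close>. With \<open>E = \<Sum> y\<^sub>i \<partial>\<^sub>i\<close> and \<open>r\<^sup>2 = \<Sum> y\<^sub>i\<^sup>2\<close> over \<open>K\<close>, and \<open>k = card K\<close>, the
  classical identity \<open>\<Sum>\<^bsub>i<j\<^esub> (y\<^sub>i \<partial>\<^sub>j - y\<^sub>j \<partial>\<^sub>i)\<^sup>2 = r\<^sup>2 \<Delta> - E\<^sup>2 - (k - 2) E\<close> turns the definition of \<open>C\<^sub>K\<close> into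
  \<open>- 1/4 \<Sum>\<^bsub>i<j\<^esub> (y\<^sub>i \<partial>\<^sub>j - y\<^sub>j \<partial>\<^sub>i)\<^sup>2 - r\<^sup>2/4 \<Sum> b\<^sub>i / y\<^sub>i\<^sup>2 + (k\<^sup>2 - 4 k)/16\<close> (lemmas
  \<open>casimir_element_eq\<close> and \<open>casimir_eq_angular\<close>). For \<open>K = [n]\<close> and \<open>r\<^sup>2 = 1\<close> this is the asserted formula.
  The formula also shows that all \<open>C\<^sub>K\<close> restrict to the sphere, because \<open>y\<^sub>i \<partial>\<^sub>j - y\<^sub>j \<partial>\<^sub>i\<close> is a tangential
  derivative (lemma \<open>angular_sphere_cong\<close>).

  The Hamiltonian agrees with \<open>- 4 C\<^bsub>[n]\<^esub> + const\<close> only on the sphere: away from it the factor \<open>r\<^sup>2\<close>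
  is missing. So commutation with \<open>H\<close> is derived on the sphere: \<open>H f\<close> may be replaced there by
  \<open>- 4 C\<^bsub>[n]\<^esub> f + const f\<close> inside \<open>C\<^sub>K\<close> because \<open>C\<^sub>K\<close> restricts, and then \<open>C\<^sub>K\<close> and \<open>C\<^bsub>[n]\<^esub>\<close> are
  exchanged.

  All identities between operators are computed in a ring. The relevant operators are linear and
  local on smooth functions; identifying those that agree on the regular region gives a real
  algebra \<open>operator\<close>, in which multiplication by \<open>y\<^sub>i\<close>, by \<open>1 / y\<^sub>i\<close> and \<open>\<partial>\<^sub>i\<close> satisfy the relations of
  a localised Weyl algebra. Analysis is needed only to establish these relations (the product rule
  and the symmetry of second derivatives) and for the restriction to the sphere.
\<close>

section \<open>Casimir elements of commuting copies of su(1,1)\<close>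

text \<open>
  In the commutator of two sums over indices only the diagonal terms survive; all brackets between
  the total generators of an index set and of a larger one are instances of this.
\<close>

lemma sum_commutator:
  fixes a b c :: "'i \<Rightarrow> 'a::ring"
  assumes "finite K" "finite L"
    and same: "\<And>i. a i * b i - b i * a i = c i"
    and other: "\<And>i j. i \<noteq> j \<Longrightarrow> a i * b j = b j * a i"
  shows "sum a K * sum b L - sum b L * sum a K = sum c (K \<inter> L)"
proof -
  have "sum b L * sum a K = (\<Sum>i\<in>K. \<Sum>j\<in>L. b j * a i)"
    unfolding sum_product by (rule sum.swap)
  then have "sum a K * sum b L - sum b L * sum a K = (\<Sum>i\<in>K. \<Sum>j\<in>L. a i * b j - b j * a i)"
    by (simp add: sum_product sum_subtractf)
  also have "\<dots> = (\<Sum>i\<in>K. \<Sum>j\<in>L. if i = j then c i else 0)"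
    using same other by (intro sum.cong) auto
  also have "\<dots> = sum c (K \<inter> L)"
    using assms(1,2) by (simp add: sum.inter_restrict)
  finally show ?thesis .
qed

locale su11_family =
  fixes p m z :: "'i \<Rightarrow> 'a::ring_1"
  assumes zp: "z i * p i - p i * z i = p i"
    and zm: "z i * m i - m i * z i = - m i"
    and mp: "m i * p i - p i * m i = z i + z i"
    and distinct_commute:
      "i \<noteq> j \<Longrightarrow> a \<in> {p i, m i, z i} \<Longrightarrow> b \<in> {p j, m j, z j} \<Longrightarrow> a * b = b * a"
begin

definition casimir_element :: "'i set \<Rightarrow> 'a" where
  "casimir_element K = sum z K * sum z K - sum z K - sum p K * sum m K"

lemma sum_relations:
  assumes "finite L" "K \<subseteq> L"
  shows "sum z K * sum p L = sum p L * sum z K + sum p K"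
    and "sum z K * sum m L = sum m L * sum z K - sum m K"
    and "sum z K * sum z L = sum z L * sum z K"
    and "sum p K * sum z L = sum z L * sum p K - sum p K"
    and "sum m K * sum z L = sum z L * sum m K + sum m K"
    and "sum p K * sum p L = sum p L * sum p K"
    and "sum m K * sum m L = sum m L * sum m K"
    and "sum m K * sum p L = sum p L * sum m K + (sum z K + sum z K)"
    and "sum p K * sum m L = sum m L * sum p K - (sum z K + sum z K)"
proof -
  have K: "finite K" "K \<inter> L = K"
    using assms finite_subset by blast+
  note bracket = sum_commutator[OF K(1) assms(1), unfolded K(2)]
  have 1: "sum z K * sum p L - sum p L * sum z K = sum p K"
    by (rule bracket) (auto simp: zp intro: distinct_commute)
  have 2: "sum z K * sum m L - sum m L * sum z K = (\<Sum>i\<in>K. - m i)"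
    by (rule bracket) (auto simp: zm intro: distinct_commute)
  have 3: "sum z K * sum z L - sum z L * sum z K = (\<Sum>i\<in>K. 0)"
    by (rule bracket) (auto intro: distinct_commute)
  have 4: "sum p K * sum z L - sum z L * sum p K = (\<Sum>i\<in>K. - p i)"
    by (rule bracket) (use zp in \<open>auto simp: algebra_simps intro: distinct_commute\<close>)
  have 5: "sum m K * sum z L - sum z L * sum m K = sum m K"
    by (rule bracket) (use zm in \<open>auto simp: algebra_simps intro: distinct_commute\<close>)
  have 6: "sum p K * sum p L - sum p L * sum p K = (\<Sum>i\<in>K. 0)"
    by (rule bracket) (auto intro: distinct_commute)
  have 7: "sum m K * sum m L - sum m L * sum m K = (\<Sum>i\<in>K. 0)"
    by (rule bracket) (auto intro: distinct_commute)
  have 8: "sum m K * sum p L - sum p L * sum m K = (\<Sum>i\<in>K. z i + z i)"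
    by (rule bracket) (auto simp: mp intro: distinct_commute)
  have 9: "sum p K * sum m L - sum m L * sum p K = (\<Sum>i\<in>K. - z i - z i)"
    by (rule bracket) (use mp in \<open>auto simp: algebra_simps intro: distinct_commute\<close>)
  show "sum z K * sum p L = sum p L * sum z K + sum p K"
    and "sum z K * sum m L = sum m L * sum z K - sum m K"
    and "sum z K * sum z L = sum z L * sum z K"
    and "sum p K * sum z L = sum z L * sum p K - sum p K"
    and "sum m K * sum z L = sum z L * sum m K + sum m K"
    and "sum p K * sum p L = sum p L * sum p K"
    and "sum m K * sum m L = sum m L * sum m K"
    and "sum m K * sum p L = sum p L * sum m K + (sum z K + sum z K)"
    and "sum p K * sum m L = sum m L * sum p K - (sum z K + sum z K)"
    using 1 2 3 4 5 6 7 8 9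
    by (simp_all add: sum_negf sum_subtractf sum.distrib algebra_simps del: sum_constant)
qed

text \<open>
  By the brackets in \<open>sum_relations\<close> each \<open>x\<^sub>K\<close> has the same bracket with \<open>y\<^sub>L\<close> as with \<open>y\<^sub>K\<close>. So this is the
  usual computation that the Casimir element is central: moving a total generator to the left through
  \<open>casimir_element K\<close> leaves a remainder in \<open>z\<^sub>K\<close>, \<open>p\<^sub>K\<close>, \<open>m\<^sub>K\<close>, which is zero by the relations of \<open>su(1,1)\<close>.
\<close>

lemma casimir_element_commute_sums:
  assumes "finite L" "K \<subseteq> L"
  shows "casimir_element K * sum p L = sum p L * casimir_element K"
    and "casimir_element K * sum m L = sum m L * casimir_element K"
    and "casimir_element K * sum z L = sum z L * casimir_element K"
proof -
  let ?z = "sum z K" and ?p = "sum p K" and ?m = "sum m K"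
  note rel = sum_relations[OF assms]
  note rel' = rel[THEN arg_cong[where f = "\<lambda>x. x * y" for y], unfolded mult.assoc]
  have K: "?z * ?p = ?p * ?z + ?p" "?z * ?m = ?m * ?z - ?m"
    using assms finite_subset by (blast intro: sum_relations)+
  have K': "?z * (?p * x) = ?p * (?z * x) + ?p * x" "?z * (?m * x) = ?m * (?z * x) - ?m * x" for x
    by (simp_all only: mult.assoc[symmetric] K) (simp_all add: algebra_simps)
  show "casimir_element K * sum p L = sum p L * casimir_element K"
    "casimir_element K * sum m L = sum m L * casimir_element K"
    "casimir_element K * sum z L = sum z L * casimir_element K"
    by (simp_all add: casimir_element_def algebra_simps rel rel' K K')
qed

lemma casimir_element_commute:
  assumes "finite L" "K \<subseteq> L"
  shows "casimir_element K * casimir_element L = casimir_element L * casimir_element K"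
proof -
  note c = casimir_element_commute_sums[OF assms]
  note c' = c[THEN arg_cong[where f = "\<lambda>x. x * y" for y], unfolded mult.assoc]
  show ?thesis
    by (simp add: casimir_element_def[of L] algebra_simps c c')
qed

end

section \<open>The realization in a localised Weyl algebra\<close>

text \<open>
  Here \<open>Y\<close>, \<open>V\<close> and \<open>D\<close> are abstract versions of multiplication by \<open>y\<^sub>i\<close>, multiplication by \<open>1 / y\<^sub>i\<close> and \<open>\<partial>\<^sub>i\<close>.
  Since \<open>V i\<close> is a two-sided inverse of \<open>Y i\<close>, the relations that involve \<open>V\<close> follow.
\<close>

locale weyl_algebra =
  fixes Y V D :: "'i \<Rightarrow> 'a::real_algebra_1"
  assumes YY: "Y i * Y j = Y j * Y i"
    and DD: "D i * D j = D j * D i"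
    and DY: "D i * Y j = Y j * D i + (if i = j then 1 else 0)"
    and YV: "Y i * V i = 1"
    and VY: "V i * Y i = 1"
begin

lemma V_commute:
  assumes "x * Y i = Y i * x"
  shows "x * V i = V i * x"
proof -
  have "x * V i = V i * (Y i * x) * V i"
    by (simp add: mult.assoc[symmetric] VY)
  also have "\<dots> = V i * (x * (Y i * V i))"
    by (simp add: assms[symmetric] mult.assoc)
  finally show ?thesis
    by (simp add: YV)
qed

lemma DV: "D i * V i = V i * D i - V i * V i"
proof -
  have "V i * (D i * Y i) * V i = V i * (Y i * D i) * V i + V i * V i"
    by (simp add: DY algebra_simps)
  moreover have "V i * (D i * Y i) * V i = V i * D i"
    by (simp add: mult.assoc YV)
  moreover have "V i * (Y i * D i) * V i = D i * V i"
    by (simp add: mult.assoc[symmetric] VY)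
  ultimately show ?thesis
    by (simp add: algebra_simps)
qed

definition jp :: "'i \<Rightarrow> 'a" where
  "jp i = (1/2) *\<^sub>R (Y i * Y i)"

definition jm :: "('i \<Rightarrow> real) \<Rightarrow> 'i \<Rightarrow> 'a" where
  "jm b i = (1/2) *\<^sub>R (D i * D i + b i *\<^sub>R (V i * V i))"

definition jz :: "'i \<Rightarrow> 'a" where
  "jz i = (1/4) *\<^sub>R (2 *\<^sub>R (Y i * D i) + 1)"

lemma su11_same:
  shows "jz i * jp i - jp i * jz i = jp i"
    and "jz i * jm b i - jm b i * jz i = - jm b i"
    and "jm b i * jp i - jp i * jm b i = jz i + jz i"
proof -
  have half: "(r/4) *\<^sub>R x + (r/4) *\<^sub>R x = (r/2) *\<^sub>R x"
    "(r/4) *\<^sub>R x + ((r/4) *\<^sub>R x + y) = (r/2) *\<^sub>R x + y" for r and x y :: 'a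
    by (simp_all add: add.assoc[symmetric] flip: scaleR_left_distrib)
  have rel: "D i * Y i = Y i * D i + 1" "D i * (Y i * x) = Y i * (D i * x) + x"
    "D i * V i = V i * D i - V i * V i" "D i * (V i * x) = V i * (D i * x) - V i * (V i * x)"
    "Y i * V i = 1" "Y i * (V i * x) = x" "V i * Y i = 1" "V i * (Y i * x) = x" for x
    by (simp_all add: mult.assoc[symmetric] DY DV YV VY) (simp_all add: algebra_simps)
  show "jz i * jp i - jp i * jz i = jp i"
    by (simp add: jz_def jp_def algebra_simps rel half)
  show "jz i * jm b i - jm b i * jz i = - jm b i"
    by (simp add: jz_def jm_def algebra_simps rel half)
  show "jm b i * jp i - jp i * jm b i = jz i + jz i"
    by (simp add: jz_def jm_def jp_def algebra_simps rel half)
qed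

definition rot :: "'i \<Rightarrow> 'i \<Rightarrow> 'a" where
  "rot i j = Y i * D j - Y j * D i"

text \<open>
  The expression on the right keeps both orders of the product of \<open>Y i * D i\<close> and \<open>Y j * D j\<close>, so that
  the sum over all pairs contains the square of the Euler operator without any reordering. The last
  summand corrects the diagonal, where both sides are zero.
\<close>

lemma rot_square:
  "rot i j * rot i j = Y i * Y i * (D j * D j) + Y j * Y j * (D i * D i)
    - Y i * D i * (Y j * D j) - Y j * D j * (Y i * D i) - Y i * D i - Y j * D j
    + (if i = j then 4 *\<^sub>R (Y i * D i) else 0)"
proof -
  have 1: "D k * (Y l * x) = Y l * (D k * x) + (if k = l then x else 0)" for k l x
    by (simp only: mult.assoc[symmetric] DY) (simp add: algebra_simps)
  have 2: "Y j * (Y i * x) = Y i * (Y j * x)" for x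
    by (simp add: mult.assoc[symmetric] YY)
  have 4: "4 *\<^sub>R x = x + (x + (x + x))" for x :: 'a
    using scaleR_left_distrib[of 2 2 x] by (simp add: scaleR_2)
  show ?thesis
  proof (cases "i = j")
    case True
    then show ?thesis
      by (simp add: rot_def algebra_simps 1 4)
  next
    case False
    then show ?thesis
      by (simp add: rot_def algebra_simps 1 2)
  qed
qed

lemma distinct_index_commute:
  assumes "i \<noteq> j" "a \<in> {Y i, V i, D i}" "c \<in> {Y j, V j, D j}"
  shows "a * c = c * a"
proof -
  have 1: "Y i * V j = V j * Y i" "D i * V j = V j * D i" "D i * Y j = Y j * D i" if "i \<noteq> j" for i j
    using that by (auto intro!: V_commute simp: YY DY)
  moreover have "V i * V j = V j * V i"
    using 1[of j i] assms(1) by (intro V_commute) simp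
  ultimately show ?thesis
    using assms 1[of j i] YY DD by auto
qed

lemma su11_commute:
  assumes "\<And>a. a \<in> {Y i, V i, D i} \<Longrightarrow> x * a = a * x" "a \<in> {jp i, jm b i, jz i}"
  shows "x * a = a * x"
proof -
  have c: "x * Y i = Y i * x" "x * V i = V i * x" "x * D i = D i * x"
    using assms(1) by simp_all
  have c': "x * (Y i * y) = Y i * (x * y)" "x * (V i * y) = V i * (x * y)" "x * (D i * y) = D i * (x * y)" for y
    by (simp_all only: mult.assoc[symmetric] c)
  show ?thesis
    using assms(2) by (auto simp: jp_def jm_def jz_def algebra_simps c c')
qed

lemma J_su11_family: "su11_family jp (jm b) jz"
proof
  fix i j a c
  assume ij: "i \<noteq> j" and ac: "a \<in> {jp i, jm b i, jz i}" "c \<in> {jp j, jm b j, jz j}"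
  have "g * a = a * g" if "g \<in> {Y j, V j, D j}" for g
    using distinct_index_commute ij that by (intro su11_commute[OF _ ac(1)]) metis
  then show "a * c = c * a"
    by (intro su11_commute[OF _ ac(2)]) simp
qed (rule su11_same)+

sublocale su11: su11_family jp "jm b" jz for b
  by (rule J_su11_family)

text \<open>
  The classical decomposition \<open>r\<^sup>2 \<Delta> = E\<^sup>2 + (k - 2) E + \<Delta>\<^bsub>LB\<^esub>\<close> of the Laplacian; the factor 2 arises because
  each unordered pair is counted twice.
\<close>

lemma sum_rot_square:
  assumes "finite K"
  shows "(\<Sum>i\<in>K. \<Sum>j\<in>K. rot i j * rot i j) =
    2 *\<^sub>R ((\<Sum>i\<in>K. Y i * Y i) * (\<Sum>i\<in>K. D i * D i) - (\<Sum>i\<in>K. Y i * D i) * (\<Sum>i\<in>K. Y i * D i)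
      - (real (card K) - 2) *\<^sub>R (\<Sum>i\<in>K. Y i * D i))"
proof -
  let ?R = "\<Sum>i\<in>K. Y i * Y i" and ?L = "\<Sum>i\<in>K. D i * D i" and ?E = "\<Sum>i\<in>K. Y i * D i"
  have "(\<Sum>i\<in>K. \<Sum>j\<in>K. rot i j * rot i j) = ?R * ?L + ?R * ?L - ?E * ?E - ?E * ?E
    - real (card K) *\<^sub>R ?E - real (card K) *\<^sub>R ?E + 4 *\<^sub>R ?E"
    unfolding rot_square sum.distrib sum_subtractf
    using assms sum.swap[of "\<lambda>i j. Y j * Y j * (D i * D i)" K K]
      sum.swap[of "\<lambda>i j. Y j * D j * (Y i * D i)" K K]
    by (simp add: sum_product scaleR_sum_right sum_constant_scaleR del: sum_constant)
  also have "\<dots> = 2 *\<^sub>R (?R * ?L - ?E * ?E - (real (card K) - 2) *\<^sub>R ?E)"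
  proof -
    have "4 *\<^sub>R x = x + (x + (x + x))" "(r * 2) *\<^sub>R x = r *\<^sub>R x + r *\<^sub>R x" for r and x :: 'a
      using scaleR_left_distrib[of 2 2 x] scaleR_left_distrib[of r r x]
      by (simp_all add: scaleR_2 mult.commute[of r 2])
    then show ?thesis
      by (simp add: algebra_simps scaleR_2)
  qed
  finally show ?thesis .
qed

text \<open>
  Here \<open>z\<^sub>K = E/2 + k/4\<close>, so \<open>z\<^sub>K\<^sup>2 - z\<^sub>K = (E\<^sup>2 + (k - 2) E)/4 + k\<^sup>2/16 - k/4\<close>. The part in \<open>E\<close> combines with
  \<open>- r\<^sup>2 \<Delta>/4\<close> from \<open>- p\<^sub>K m\<^sub>K\<close> to the angular part of the Laplacian.
\<close>

lemma casimir_element_eq: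
  assumes "finite K"
  shows "su11.casimir_element b K = (- 1/8) *\<^sub>R (\<Sum>i\<in>K. \<Sum>j\<in>K. rot i j * rot i j)
    - (1/4) *\<^sub>R ((\<Sum>i\<in>K. Y i * Y i) * (\<Sum>i\<in>K. b i *\<^sub>R (V i * V i)))
    + (((real (card K))\<^sup>2 - 4 * real (card K)) / 16) *\<^sub>R 1"
proof -
  define R L E W where RLEW: "R = (\<Sum>i\<in>K. Y i * Y i)" "L = (\<Sum>i\<in>K. D i * D i)"
    "E = (\<Sum>i\<in>K. Y i * D i)" "W = (\<Sum>i\<in>K. b i *\<^sub>R (V i * V i))"
  let ?k = "real (card K)"
  have z: "sum jz K = (1/2) *\<^sub>R E + (?k/4) *\<^sub>R 1"
    by (simp add: jz_def RLEW scaleR_add_right sum.distrib scaleR_sum_right sum_constant_scaleR del: sum_constant)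
  have p: "sum jp K = (1/2) *\<^sub>R R"
    by (simp add: jp_def RLEW scaleR_sum_right)
  have m: "sum (jm b) K = (1/2) *\<^sub>R L + (1/2) *\<^sub>R W"
    by (simp add: jm_def RLEW scaleR_add_right sum.distrib scaleR_sum_right)
  have "su11.casimir_element b K = (1/4) *\<^sub>R (E * E) + (?k/4 - 1/2) *\<^sub>R E + (?k\<^sup>2/16 - ?k/4) *\<^sub>R 1
      - (1/4) *\<^sub>R (R * L) - (1/4) *\<^sub>R (R * W)"
  proof -
    have "(?k/8) *\<^sub>R E + (?k/8) *\<^sub>R E = (?k/4) *\<^sub>R E"
      by (simp flip: scaleR_left_distrib)
    then show ?thesis
      by (simp add: su11.casimir_element_def z p m algebra_simps power2_eq_square)
  qed
  also have "\<dots> = (- 1/8) *\<^sub>R (2 *\<^sub>R (R * L - E * E - (?k - 2) *\<^sub>R E)) - (1/4) *\<^sub>R (R * W)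
      + ((?k\<^sup>2 - 4 * ?k) / 16) *\<^sub>R 1"
    by (simp add: algebra_simps diff_divide_distrib)
  finally show ?thesis
    by (simp add: sum_rot_square[OF assms] RLEW)
qed

end

section \<open>Smooth functions on the regular region\<close>

lemma open_regular_region: "open (regular_region :: (real ^ 'n::finite) set)"
proof -
  have "(regular_region :: (real ^ 'n) set) = (\<Inter>i. {y. y $ i \<noteq> 0})"
    by (auto simp: regular_region_def)
  moreover have "open (\<Inter>i. {y :: real ^ 'n. y $ i \<noteq> 0})"
    by (intro open_INT finite ballI open_Collect_neq continuous_intros)
  ultimately show ?thesis
    by simp
qed

lemma has_derivative_imp_partial:
  "(f has_derivative f') (at y) \<Longrightarrow> partial i f y = f' (axis i 1)"
  unfolding partial_def by (metis frechet_derivative_at)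

lemma partial_cong:
  assumes "open U" "y \<in> U" "\<And>x. x \<in> U \<Longrightarrow> f x = g x"
  shows "partial i f y = partial i g y"
proof -
  have "(f has_derivative f') (at y) \<longleftrightarrow> (g has_derivative f') (at y)" for f'
    using has_derivative_transform_within_open[OF _ assms(1,2)] assms(3) by metis
  then show ?thesis
    by (simp add: partial_def frechet_derivative_def)
qed

lemma differentiable_on_cong_open:
  assumes "open U" "\<And>x. x \<in> U \<Longrightarrow> f x = g x" "f differentiable_on U"
  shows "g differentiable_on U"
  unfolding differentiable_on_eq_differentiable_at[OF assms(1)] differentiable_def
proof
  fix x assume x: "x \<in> U"
  then obtain f' where "(f has_derivative f') (at x)"
    using assms(1,3) by (auto simp: differentiable_on_eq_differentiable_at differentiable_def)
  from has_derivative_transform_within_open[OF this assms(1) x] assms(2)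
  show "\<exists>g'. (g has_derivative g') (at x)"
    by blast
qed

lemma Ck_on_cong:
  assumes "open U" "\<And>x. x \<in> U \<Longrightarrow> f x = g x" "Ck_on k U f"
  shows "Ck_on k U g"
  using assms(2,3)
proof (induction k arbitrary: f g)
  case (0 f g)
  then show ?case
    using continuous_on_cong[of U U f g] by simp
next
  case (Suc k f g)
  have "partial i f x = partial i g x" if "x \<in> U" for i x
    using partial_cong[OF assms(1) that] Suc.prems(1) by blast
  then have "Ck_on k U (partial i g)" for i
    using Suc.IH[of "partial i f" "partial i g"] Suc.prems(2) by simp
  moreover have "g differentiable_on U"
    using differentiable_on_cong_open[OF assms(1), of f g] Suc.prems by simp
  ultimately show ?case
    by simp
qed

lemma Ck_on_continuous: "Ck_on k U f \<Longrightarrow> continuous_on U f"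
  by (cases k) (auto intro: differentiable_imp_continuous_on)

lemma Ck_on_Suc_imp: "Ck_on (Suc k) U f \<Longrightarrow> Ck_on k U f"
proof (induction k arbitrary: f)
  case (0 f)
  then show ?case
    by (simp add: differentiable_imp_continuous_on)
next
  case (Suc k f)
  then show ?case
    unfolding Ck_on.simps(2)[of "Suc k"] Ck_on.simps(2)[of k U f] by blast
qed

lemma partial_add:
  assumes "f differentiable at y" "g differentiable at y"
  shows "partial i (\<lambda>x. f x + g x) y = partial i f y + partial i g y"
  using has_derivative_imp_partial[OF has_derivative_add]
    assms[unfolded frechet_derivative_works] unfolding partial_def by fast

lemma partial_mult:
  assumes "f differentiable at y" "g differentiable at y"
  shows "partial i (\<lambda>x. f x * g x) y = f y * partial i g y + partial i f y * g y"
  using has_derivative_imp_partial[OF has_derivative_mult]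
    assms[unfolded frechet_derivative_works] unfolding partial_def by fast

lemma partial_const: "partial i (\<lambda>x. c) y = 0"
  by (rule has_derivative_imp_partial) simp

lemma Ck_on_const:
  fixes U :: "(real ^ 'n::finite) set"
  shows "Ck_on k U (\<lambda>x. c)"
proof (induction k arbitrary: c)
  case (Suc k c)
  have "partial i (\<lambda>x::real ^ 'n. c) = (\<lambda>x. 0)" for i
    by (simp add: partial_const fun_eq_iff)
  with Suc show ?case
    by simp
qed simp

lemma Ck_on_add:
  assumes "open U" "Ck_on k U f" "Ck_on k U g"
  shows "Ck_on k U (\<lambda>x. f x + g x)"
  using assms(2,3)
proof (induction k arbitrary: f g)
  case (0 f g)
  then show ?case
    by (simp add: continuous_on_add)
next
  case (Suc k f g)
  have d: "f differentiable_on U" "g differentiable_on U"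
    using Suc.prems by auto
  have "Ck_on k U (partial i (\<lambda>x. f x + g x))" for i
  proof (rule Ck_on_cong[OF assms(1)])
    show "Ck_on k U (\<lambda>x. partial i f x + partial i g x)"
      using Suc by simp
    show "partial i f x + partial i g x = partial i (\<lambda>x. f x + g x) x" if "x \<in> U" for x
      using that d assms(1) by (simp add: partial_add differentiable_on_eq_differentiable_at)
  qed
  with d show ?case
    by (simp add: differentiable_on_def)
qed

lemma Ck_on_mult:
  assumes "open U" "Ck_on k U f" "Ck_on k U g"
  shows "Ck_on k U (\<lambda>x. f x * g x)"
  using assms(2,3)
proof (induction k arbitrary: f g)
  case (0 f g)
  then show ?case
    by (simp add: continuous_on_mult)
next
  case (Suc k f g)
  have d: "f differentiable_on U" "g differentiable_on U"
    using Suc.prems by auto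
  have "Ck_on k U (partial i (\<lambda>x. f x * g x))" for i
  proof (rule Ck_on_cong[OF assms(1)])
    show "Ck_on k U (\<lambda>x. f x * partial i g x + partial i f x * g x)"
      using Suc.prems by (intro Ck_on_add assms(1) Suc.IH) (auto simp: Ck_on_Suc_imp)
    show "f x * partial i g x + partial i f x * g x = partial i (\<lambda>x. f x * g x) x" if "x \<in> U" for x
      using that d assms(1) by (simp add: partial_mult differentiable_on_eq_differentiable_at)
  qed
  with d show ?case
    by (simp add: differentiable_on_def)
qed

lemma smooth_cong: "smooth f \<Longrightarrow> (\<And>y. y \<in> regular_region \<Longrightarrow> f y = g y) \<Longrightarrow> smooth g"
  unfolding smooth_def using Ck_on_cong[OF open_regular_region] by blast

lemma smooth_differentiable: "smooth f \<Longrightarrow> y \<in> regular_region \<Longrightarrow> f differentiable at y"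
  unfolding smooth_def
  by (metis Ck_on.simps(2) differentiable_on_eq_differentiable_at open_regular_region)

lemma smooth_has_derivative:
  "smooth f \<Longrightarrow> y \<in> regular_region \<Longrightarrow> (f has_derivative frechet_derivative f (at y)) (at y)"
  using smooth_differentiable frechet_derivative_works by blast

lemma smooth_partial: "smooth f \<Longrightarrow> smooth (partial i f)"
  unfolding smooth_def by (metis Ck_on.simps(2))

lemma smooth_continuous: "smooth f \<Longrightarrow> continuous_on regular_region f"
  unfolding smooth_def using Ck_on_continuous by blast

lemma smooth_const: "smooth (\<lambda>y. c)"
  by (simp add: smooth_def Ck_on_const)

lemma smooth_add: "smooth f \<Longrightarrow> smooth g \<Longrightarrow> smooth (\<lambda>y. f y + g y)"
  by (simp add: smooth_def Ck_on_add open_regular_region)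

lemma smooth_mult: "smooth f \<Longrightarrow> smooth g \<Longrightarrow> smooth (\<lambda>y. f y * g y)"
  by (simp add: smooth_def Ck_on_mult open_regular_region)

text \<open>
  The coordinates are taken complex-valued so that they multiply wave functions within \<open>smooth\<close>.
\<close>

definition coord :: "'n \<Rightarrow> real ^ 'n \<Rightarrow> complex" where
  "coord i y = of_real (y $ i)"

lemma has_derivative_coord: "(coord i has_derivative coord i) (at y)"
  unfolding coord_def
  by (intro bounded_linear_imp_has_derivative
      bounded_linear_compose[OF bounded_linear_of_real bounded_linear_vec_nth])

lemma partial_coord: "partial j (coord i) y = (if i = j then 1 else 0)"
  unfolding has_derivative_imp_partial[OF has_derivative_coord]
  by (simp add: coord_def axis_def)

lemma smooth_coord: "smooth (coord i)"
  unfolding smooth_def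
proof
  fix k
  have p: "partial j (coord i) = (\<lambda>y. if i = j then 1 else 0)" for j :: 'a
    by (simp add: partial_coord fun_eq_iff)
  have d: "coord i differentiable_on S" for S
    using has_derivative_coord unfolding differentiable_on_def
    by (blast intro: differentiableI differentiable_at_withinI)
  then show "Ck_on k regular_region (coord i)"
    by (cases k) (simp_all add: p Ck_on_const differentiable_imp_continuous_on del: if_split)
qed

lemma coord_nonzero: "y \<in> regular_region \<Longrightarrow> coord i y \<noteq> 0"
  by (simp add: coord_def regular_region_def)

lemma has_derivative_inverse_coord:
  assumes "y \<in> regular_region"
  shows "((\<lambda>x. inverse (coord i x)) has_derivative
      (\<lambda>h. - (inverse (coord i y) * coord i h * inverse (coord i y)))) (at y)"
  using coord_nonzero[OF assms] by (intro Deriv.has_derivative_inverse has_derivative_coord)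

lemma partial_inverse_coord:
  assumes "y \<in> regular_region"
  shows "partial j (\<lambda>x. inverse (coord i x)) y = (if i = j then - (inverse (coord i y))\<^sup>2 else 0)"
  unfolding has_derivative_imp_partial[OF has_derivative_inverse_coord[OF assms]]
  by (simp add: coord_def axis_def power2_eq_square)

text \<open>
  Every partial derivative of \<open>u = 1 / y\<^sub>i\<close> is a constant multiple of \<open>u * u\<close>; so the order of
  differentiability rises by induction through the product rule.
\<close>

lemma smooth_inverse_coord: "smooth (\<lambda>y. inverse (coord i y))"
  unfolding smooth_def
proof
  fix k
  let ?u = "\<lambda>y. inverse (coord i y)"
  have d: "?u differentiable_on regular_region"
    using has_derivative_inverse_coord unfolding differentiable_on_def
    by (blast intro: differentiableI differentiable_at_withinI)
  show "Ck_on k regular_region ?u"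
  proof (induction k)
    case 0
    then show ?case
      using d by (simp add: differentiable_imp_continuous_on)
  next
    case (Suc k)
    have "Ck_on k regular_region (partial j ?u)" for j
    proof (rule Ck_on_cong[OF open_regular_region])
      show "Ck_on k regular_region (\<lambda>y. (if i = j then -1 else 0) * (?u y * ?u y))"
        by (intro Ck_on_mult open_regular_region Suc Ck_on_const)
    qed (simp add: partial_inverse_coord power2_eq_square)
    with d show ?case
      by simp
  qed
qed

section \<open>Symmetry of mixed partial derivatives\<close>

text \<open>
  Two applications of the mean value theorem to the second difference over the square of side \<open>h\<close>.
\<close>

lemma mixed_difference_mvt:
  fixes g gs gst :: "real \<Rightarrow> real \<Rightarrow> real"
  assumes "0 < h"
    and gs: "\<And>s t. \<lbrakk>0 \<le> s; s \<le> h; 0 \<le> t; t \<le> h\<rbrakk> \<Longrightarrow> ((\<lambda>s. g s t) has_real_derivative gs s t) (at s)"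
    and gst: "\<And>s t. \<lbrakk>0 \<le> s; s \<le> h; 0 \<le> t; t \<le> h\<rbrakk> \<Longrightarrow> ((\<lambda>t. gs s t) has_real_derivative gst s t) (at t)"
  obtains s t where "0 < s" "s < h" "0 < t" "t < h"
    "g h h - g h 0 - g 0 h + g 0 0 = h * h * gst s t"
proof -
  have "\<exists>s. 0 < s \<and> s < h \<and> (g h h - g h 0) - (g 0 h - g 0 0) = (h - 0) * (gs s h - gs s 0)"
    using assms(1) by (intro MVT2 DERIV_diff gs) auto
  then obtain s where s: "0 < s" "s < h" "(g h h - g h 0) - (g 0 h - g 0 0) = h * (gs s h - gs s 0)"
    by auto
  have "\<exists>t. 0 < t \<and> t < h \<and> gs s h - gs s 0 = (h - 0) * gst s t"
    using assms(1) s by (intro MVT2 gst) auto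
  then obtain t where t: "0 < t" "t < h" "gs s h - gs s 0 = h * gst s t"
    by auto
  show ?thesis
    by (rule that[OF s(1,2) t(1,2)]) (use s(3) t(3) in simp)
qed

text \<open>
  The second difference is symmetric in the two variables. Hence its two mean value expressions, one
  for each order of differentiation, agree; both converge to the values at the origin as the square
  shrinks.
\<close>

lemma mixed_derivatives_eq:
  fixes g gs gt gst gts :: "real \<Rightarrow> real \<Rightarrow> real"
  assumes "0 < d"
    and gs: "\<And>s t. \<lbrakk>\<bar>s\<bar> < d; \<bar>t\<bar> < d\<rbrakk> \<Longrightarrow> ((\<lambda>s. g s t) has_real_derivative gs s t) (at s)"
    and gt: "\<And>s t. \<lbrakk>\<bar>s\<bar> < d; \<bar>t\<bar> < d\<rbrakk> \<Longrightarrow> ((\<lambda>t. g s t) has_real_derivative gt s t) (at t)"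
    and gst: "\<And>s t. \<lbrakk>\<bar>s\<bar> < d; \<bar>t\<bar> < d\<rbrakk> \<Longrightarrow> ((\<lambda>t. gs s t) has_real_derivative gst s t) (at t)"
    and gts: "\<And>s t. \<lbrakk>\<bar>s\<bar> < d; \<bar>t\<bar> < d\<rbrakk> \<Longrightarrow> ((\<lambda>s. gt s t) has_real_derivative gts s t) (at s)"
    and cst: "isCont (\<lambda>(s, t). gst s t) (0, 0)"
    and cts: "isCont (\<lambda>(s, t). gts s t) (0, 0)"
  shows "gst 0 0 = gts 0 0"
proof -
  \<comment> \<open>Squares with sides shrinking to zero, all inside the domain where the derivatives exist.\<close>
  define h where "h n = d / real (Suc (Suc n))" for n
  have h: "0 < h n" "h n < d" for n
    using assms(1) by (auto simp: h_def divide_simps)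
  have h0: "h \<longlonglongrightarrow> 0"
    unfolding h_def by (rule LIMSEQ_Suc[OF LIMSEQ_Suc[OF lim_const_over_n]])
  have "\<exists>s t s' t'. 0 < s \<and> s < h n \<and> 0 < t \<and> t < h n \<and> 0 < s' \<and> s' < h n \<and> 0 < t' \<and> t' < h n
      \<and> gst s t = gts s' t'" for n
  proof -
    have lt: "\<bar>x\<bar> < d" if "0 \<le> x" "x \<le> h n" for x
      using h[of n] that by linarith
    obtain s t where st: "0 < s" "s < h n" "0 < t" "t < h n"
        "g (h n) (h n) - g (h n) 0 - g 0 (h n) + g 0 0 = h n * h n * gst s t"
      by (rule mixed_difference_mvt[of "h n" g gs gst]) (auto intro: h lt gs gst)
    obtain t' s' where st': "0 < t'" "t' < h n" "0 < s'" "s' < h n"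
        "g (h n) (h n) - g 0 (h n) - g (h n) 0 + g 0 0 = h n * h n * gts s' t'"
      by (rule mixed_difference_mvt[of "h n" "\<lambda>t s. g s t" "\<lambda>t s. gt s t" "\<lambda>t s. gts s t"])
        (auto intro: h lt gt gts)
    have "h n * h n * gst s t = h n * h n * gts s' t'"
      using st(5) st'(5) by linarith
    then have "gst s t = gts s' t'"
      using h(1)[of n] by simp
    with st st' show ?thesis
      by blast
  qed
  then obtain s t s' t' where b: "\<And>n. 0 < s n \<and> s n < h n \<and> 0 < t n \<and> t n < h n
      \<and> 0 < s' n \<and> s' n < h n \<and> 0 < t' n \<and> t' n < h n \<and> gst (s n) (t n) = gts (s' n) (t' n)"
    by metis
  have lim0: "x \<longlonglongrightarrow> 0" if "\<And>n. 0 < x n \<and> x n < h n" for x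
    by (rule tendsto_sandwich[OF _ _ tendsto_const h0]) (simp_all add: that less_imp_le)
  have "(\<lambda>n. (\<lambda>(s, t). gst s t) (s n, t n)) \<longlonglongrightarrow> (\<lambda>(s, t). gst s t) (0, 0)"
    using b by (intro isCont_tendsto_compose[OF cst] tendsto_Pair lim0) auto
  moreover have "(\<lambda>n. (\<lambda>(s, t). gts s t) (s' n, t' n)) \<longlonglongrightarrow> (\<lambda>(s, t). gts s t) (0, 0)"
    using b by (intro isCont_tendsto_compose[OF cts] tendsto_Pair lim0) auto
  ultimately show ?thesis
    using b LIMSEQ_unique by fastforce
qed

lemma partial_along_axis:
  assumes "smooth f" "y + s *\<^sub>R axis i 1 \<in> regular_region"
  shows "((\<lambda>s. f (y + s *\<^sub>R axis i 1)) has_vector_derivative partial i f (y + s *\<^sub>R axis i 1)) (at s)"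
proof -
  have "((\<lambda>s. y + s *\<^sub>R axis i 1) has_vector_derivative axis i 1) (at s)"
    by (auto intro!: derivative_eq_intros)
  from vector_derivative_diff_chain_within[OF this, where g=f] show ?thesis
    using smooth_has_derivative[OF assms]
    by (simp add: o_def partial_def has_derivative_at_withinI)
qed

text \<open>
  The mean value theorem is about real functions, so it is applied to the real and the imaginary part,
  both covered by the bounded linear functional \<open>l\<close>.
\<close>

lemma partial_commute:
  assumes f: "smooth f" and y: "y \<in> regular_region"
  shows "partial i (partial j f) y = partial j (partial i f) y"
proof -
  obtain e where e: "e > 0" "ball y e \<subseteq> regular_region"
    using open_regular_region y open_contains_ball by blast
  define P where "P s t = y + s *\<^sub>R axis i 1 + t *\<^sub>R axis j 1" for s t :: real
  have P': "P s t = (y + t *\<^sub>R axis j 1) + s *\<^sub>R axis i 1" for s t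
    by (simp add: P_def)
  have P: "P s t \<in> regular_region" if "\<bar>s\<bar> < e/2" "\<bar>t\<bar> < e/2" for s t
  proof -
    have "dist y (P s t) = norm (s *\<^sub>R axis i 1 + t *\<^sub>R axis j (1::real))"
      by (simp add: P_def dist_norm norm_minus_commute algebra_simps)
    also have "\<dots> \<le> \<bar>s\<bar> + \<bar>t\<bar>"
      by (rule norm_triangle_le) (simp add: norm_axis_1)
    finally show ?thesis
      using e that by (auto simp: subset_iff)
  qed
  have [simp]: "smooth (partial k u)" if "smooth u" for k u
    using smooth_partial that .
  have ds: "((\<lambda>s. u (P s t)) has_vector_derivative partial i u (P s t)) (at s)"
    if "smooth u" "\<bar>s\<bar> < e/2" "\<bar>t\<bar> < e/2" for u s t
    using partial_along_axis[OF that(1)] P[OF that(2,3)] unfolding P' by blast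
  have dt: "((\<lambda>t. u (P s t)) has_vector_derivative partial j u (P s t)) (at t)"
    if "smooth u" "\<bar>s\<bar> < e/2" "\<bar>t\<bar> < e/2" for u s t
    using partial_along_axis[OF that(1)] P[OF that(2,3)] unfolding P_def by blast
  have P0: "P 0 0 = y"
    by (simp add: P_def)
  have cont: "isCont (\<lambda>(s, t). u (P s t)) (0, 0)" if "smooth u" for u
  proof -
    have "isCont u (P 0 0)"
      using smooth_continuous[OF that] y P0 continuous_on_eq_continuous_at[OF open_regular_region]
      by blast
    moreover have "isCont (\<lambda>p. P (fst p) (snd p)) (0, 0)"
      unfolding P_def by (intro continuous_intros)
    ultimately show ?thesis
      using isCont_o2[of "(0, 0)" "\<lambda>p. P (fst p) (snd p)" u] by (simp add: case_prod_unfold)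
  qed
  have eq: "l (partial j (partial i f) (P 0 0)) = l (partial i (partial j f) (P 0 0))"
    if l: "bounded_linear l" for l :: "complex \<Rightarrow> real"
  proof (rule mixed_derivatives_eq[of "e/2" "\<lambda>s t. l (f (P s t))" "\<lambda>s t. l (partial i f (P s t))"
        "\<lambda>s t. l (partial j f (P s t))" "\<lambda>s t. l (partial j (partial i f) (P s t))"
        "\<lambda>s t. l (partial i (partial j f) (P s t))"])
    show "isCont (\<lambda>(s, t). l (partial j (partial i f) (P s t))) (0, 0)"
      using bounded_linear.isCont[OF l cont[of "partial j (partial i f)"]] f
      by (simp add: case_prod_unfold)
    show "isCont (\<lambda>(s, t). l (partial i (partial j f) (P s t))) (0, 0)"
      using bounded_linear.isCont[OF l cont[of "partial i (partial j f)"]] f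
      by (simp add: case_prod_unfold)
    fix s t :: real assume st: "\<bar>s\<bar> < e / 2" "\<bar>t\<bar> < e / 2"
    note l' = bounded_linear.has_vector_derivative[OF l]
    show "((\<lambda>s. l (f (P s t))) has_real_derivative l (partial i f (P s t))) (at s)"
      "((\<lambda>t. l (f (P s t))) has_real_derivative l (partial j f (P s t))) (at t)"
      "((\<lambda>t. l (partial i f (P s t))) has_real_derivative l (partial j (partial i f) (P s t))) (at t)"
      "((\<lambda>s. l (partial j f (P s t))) has_real_derivative l (partial i (partial j f) (P s t))) (at s)"
      unfolding has_real_derivative_iff_has_vector_derivative
      by (rule l'[OF ds] l'[OF dt], use f st in simp_all)+
  qed (use e in simp)
  show ?thesis
    using eq[OF bounded_linear_Re] eq[OF bounded_linear_Im] by (simp add: P0 complex_eq_iff)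
qed

section \<open>The algebra of linear local operators on smooth functions\<close>

text \<open>
  Functions are total, but only values on the regular region are meaningful. Compatibility with equality
  on that region makes composition well defined on classes of operators; linearity on smooth functions
  gives the distributive law \<open>a * (b + c) = a * b + a * c\<close>, which fails for arbitrary maps (and for
  \<open>partial i\<close> on functions that are not differentiable).
\<close>

definition smooth_op :: "'n::finite diffop \<Rightarrow> bool" where
  "smooth_op A \<longleftrightarrow> preserves_smooth A
    \<and> (\<forall>f g. smooth f \<longrightarrow> smooth g \<longrightarrow> (\<forall>y\<in>regular_region. f y = g y) \<longrightarrow>
         (\<forall>y\<in>regular_region. A f y = A g y))
    \<and> (\<forall>f g. smooth f \<longrightarrow> smooth g \<longrightarrow>
         (\<forall>y\<in>regular_region. A (\<lambda>x. f x + g x) y = A f y + A g y))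
    \<and> (\<forall>c f. smooth f \<longrightarrow> (\<forall>y\<in>regular_region. A (\<lambda>x. c * f x) y = c * A f y))"

lemma smooth_op_smooth: "smooth_op A \<Longrightarrow> smooth f \<Longrightarrow> smooth (A f)"
  by (simp add: smooth_op_def preserves_smooth_def)

lemma smooth_op_local:
  "\<lbrakk>smooth_op A; smooth f; smooth g; \<And>y. y \<in> regular_region \<Longrightarrow> f y = g y; y \<in> regular_region\<rbrakk>
    \<Longrightarrow> A f y = A g y"
  unfolding smooth_op_def by blast

lemma smooth_op_additive:
  "\<lbrakk>smooth_op A; smooth f; smooth g; y \<in> regular_region\<rbrakk>
    \<Longrightarrow> A (\<lambda>x. f x + g x) y = A f y + A g y"
  unfolding smooth_op_def by blast

lemma smooth_op_scale:
  "\<lbrakk>smooth_op A; smooth f; y \<in> regular_region\<rbrakk> \<Longrightarrow> A (\<lambda>x. c * f x) y = c * A f y"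
  unfolding smooth_op_def by blast

lemma smooth_opI:
  assumes "\<And>f. smooth f \<Longrightarrow> smooth (A f)"
    and "\<And>f g y. \<lbrakk>smooth f; smooth g; \<And>y. y \<in> regular_region \<Longrightarrow> f y = g y; y \<in> regular_region\<rbrakk>
      \<Longrightarrow> A f y = A g y"
    and "\<And>f g y. \<lbrakk>smooth f; smooth g; y \<in> regular_region\<rbrakk> \<Longrightarrow> A (\<lambda>x. f x + g x) y = A f y + A g y"
    and "\<And>c f y. \<lbrakk>smooth f; y \<in> regular_region\<rbrakk> \<Longrightarrow> A (\<lambda>x. c * f x) y = c * A f y"
  shows "smooth_op A"
  unfolding smooth_op_def preserves_smooth_def
  by (intro conjI allI impI ballI) (simp_all add: assms(1,3,4), rule assms(2), simp_all)

lemma smooth_op_mult: "smooth h \<Longrightarrow> smooth_op (\<lambda>f y. h y * f y)"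
  by (rule smooth_opI) (simp_all add: smooth_mult algebra_simps)

lemma smooth_op_id: "smooth_op (\<lambda>f. f)"
  by (rule smooth_opI) simp_all

lemma smooth_op_zero: "smooth_op (\<lambda>f y. 0)"
  by (rule smooth_opI) (simp_all add: smooth_const)

lemma smooth_op_compose:
  fixes A B :: "'n::finite diffop"
  assumes A: "smooth_op A" and B: "smooth_op B"
  shows "smooth_op (\<lambda>f. A (B f))"
proof (rule smooth_opI)
  note sm = smooth_op_smooth[OF A] smooth_op_smooth[OF B] smooth_add smooth_mult[OF smooth_const]
  show "smooth (A (B f))" if "smooth f" for f
    using that by (simp add: sm)
  fix f g :: "real ^ 'n \<Rightarrow> complex" and c and y :: "real ^ 'n"
  assume f: "smooth f" and y: "y \<in> regular_region"
  have "A (B (\<lambda>x. c * f x)) y = A (\<lambda>x. c * B f x) y"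
    by (rule smooth_op_local[OF A]) (simp_all add: f y sm smooth_op_scale[OF B])
  then show "A (B (\<lambda>x. c * f x)) y = c * A (B f) y"
    by (simp add: smooth_op_scale[OF A] f y sm)
  assume g: "smooth g"
  have "A (B (\<lambda>x. f x + g x)) y = A (\<lambda>x. B f x + B g x) y"
    by (rule smooth_op_local[OF A]) (simp_all add: f g y sm smooth_op_additive[OF B])
  then show "A (B (\<lambda>x. f x + g x)) y = A (B f) y + A (B g) y"
    by (simp add: smooth_op_additive[OF A] f g y sm)
  assume "\<And>y. y \<in> regular_region \<Longrightarrow> f y = g y"
  then show "A (B f) y = A (B g) y"
    by (intro smooth_op_local[OF A] smooth_op_local[OF B]) (simp_all add: f g y sm)
qed

lemma smooth_op_add:
  assumes A: "smooth_op A" and B: "smooth_op B"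
  shows "smooth_op (\<lambda>f y. A f y + B f y)"
proof (rule smooth_opI)
  show "smooth (\<lambda>y. A f y + B f y)" if "smooth f" for f
    using that by (simp add: smooth_add smooth_op_smooth A B)
  show "A f y + B f y = A g y + B g y"
    if "smooth f" "smooth g" "\<And>y. y \<in> regular_region \<Longrightarrow> f y = g y" "y \<in> regular_region" for f g y
    using smooth_op_local[OF A that] smooth_op_local[OF B that] by simp
qed (simp_all add: smooth_op_additive smooth_op_scale A B algebra_simps)

lemma smooth_op_scaleR:
  assumes "smooth_op A"
  shows "smooth_op (\<lambda>f y. c *\<^sub>R A f y)"
  using smooth_op_compose[OF smooth_op_mult[OF smooth_const[of "of_real c"]] assms]
  by (simp add: scaleR_conv_of_real)

lemma smooth_op_uminus: "smooth_op A \<Longrightarrow> smooth_op (\<lambda>f y. - A f y)"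
  using smooth_op_scaleR[of A "-1"] by simp

lemma smooth_op_diff: "smooth_op A \<Longrightarrow> smooth_op B \<Longrightarrow> smooth_op (\<lambda>f y. A f y - B f y)"
  using smooth_op_add[OF _ smooth_op_uminus, of A B] by simp

lemma smooth_op_cong:
  assumes A: "smooth_op A" and eq: "\<And>f y. smooth f \<Longrightarrow> y \<in> regular_region \<Longrightarrow> A f y = B f y"
  shows "smooth_op B"
proof (rule smooth_opI)
  show "smooth (B f)" if "smooth f" for f
    using smooth_cong[OF smooth_op_smooth[OF A that]] eq that by blast
  show "B f y = B g y"
    if "smooth f" "smooth g" "\<And>y. y \<in> regular_region \<Longrightarrow> f y = g y" "y \<in> regular_region" for f g y
    using smooth_op_local[OF A that] eq that by simp
qed (simp_all add: eq[symmetric] A smooth_op_additive smooth_op_scale smooth_add smooth_mult smooth_const)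

definition smooth_op_eq :: "'n::finite diffop \<Rightarrow> 'n diffop \<Rightarrow> bool" where
  "smooth_op_eq A B \<longleftrightarrow> smooth_op A \<and> smooth_op B \<and> op_eq_on regular_region A B"

quotient_type 'n operator = "'n::finite diffop" / partial: smooth_op_eq
proof (rule part_equivpI)
  show "\<exists>A :: 'n diffop. smooth_op_eq A A"
    using smooth_op_id by (auto simp: smooth_op_eq_def op_eq_on_def)
qed (auto simp: smooth_op_eq_def op_eq_on_def intro!: sympI transpI)

instantiation operator :: (finite) real_algebra_1
begin

lift_definition zero_operator :: "'a operator" is "\<lambda>f y. 0"
  by (simp add: smooth_op_eq_def op_eq_on_def smooth_op_zero)

lift_definition one_operator :: "'a operator" is "\<lambda>f. f"
  by (simp add: smooth_op_eq_def op_eq_on_def smooth_op_id)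

lift_definition plus_operator :: "'a operator \<Rightarrow> 'a operator \<Rightarrow> 'a operator"
  is "\<lambda>A B f y. A f y + B f y"
  by (simp add: smooth_op_eq_def op_eq_on_def smooth_op_add)

lift_definition minus_operator :: "'a operator \<Rightarrow> 'a operator \<Rightarrow> 'a operator"
  is "\<lambda>A B f y. A f y - B f y"
  by (simp add: smooth_op_eq_def op_eq_on_def smooth_op_diff)

lift_definition uminus_operator :: "'a operator \<Rightarrow> 'a operator"
  is "\<lambda>A f y. - A f y"
  by (simp add: smooth_op_eq_def op_eq_on_def smooth_op_uminus)

lift_definition times_operator :: "'a operator \<Rightarrow> 'a operator \<Rightarrow> 'a operator"
  is "\<lambda>A B f. A (B f)"
proof -
  fix A A' B B' :: "'a diffop"
  assume "smooth_op_eq A A'" "smooth_op_eq B B'"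
  then have A: "smooth_op A" "smooth_op A'" "op_eq_on regular_region A A'"
    and B: "smooth_op B" "smooth_op B'" "op_eq_on regular_region B B'"
    by (simp_all add: smooth_op_eq_def)
  have "A (B f) y = A' (B' f) y" if f: "smooth f" and y: "y \<in> regular_region" for f y
  proof -
    have "A (B f) y = A' (B f) y"
      using A B f y by (simp add: op_eq_on_def smooth_op_smooth)
    also have "\<dots> = A' (B' f) y"
      using B f y by (intro smooth_op_local[OF A(2)]) (auto simp: op_eq_on_def smooth_op_smooth)
    finally show ?thesis .
  qed
  with A B show "smooth_op_eq (\<lambda>f. A (B f)) (\<lambda>f. A' (B' f))"
    by (simp add: smooth_op_eq_def op_eq_on_def smooth_op_compose)
qed

lift_definition scaleR_operator :: "real \<Rightarrow> 'a operator \<Rightarrow> 'a operator"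
  is "\<lambda>c A f y. c *\<^sub>R A f y"
  by (simp add: smooth_op_eq_def op_eq_on_def smooth_op_scaleR)

instance
proof
  fix a b c :: "'a operator" and r s :: real
  have eqI: "smooth_op_eq A B"
    if "smooth_op A" "\<And>f y. smooth f \<Longrightarrow> y \<in> regular_region \<Longrightarrow> A f y = B f y" for A B :: "'a diffop"
    using that smooth_op_cong[OF that] by (simp add: smooth_op_eq_def op_eq_on_def)
  have op: "smooth_op A" if "smooth_op_eq A A" for A :: "'a diffop"
    using that by (simp add: smooth_op_eq_def)
  show "a + b + c = a + (b + c)"
    by (transfer, rule eqI) (auto intro!: smooth_op_add simp: op add.assoc add.commute)
  show "a + b = b + a"
    by (transfer, rule eqI) (auto intro!: smooth_op_add simp: op add.assoc add.commute)
  show "0 + a = a"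
    by (transfer, rule eqI) (auto simp: op)
  show "- a + a = 0"
    by (transfer, rule eqI) (auto simp: smooth_op_zero)
  show "a - b = a + - b"
    by (transfer, rule eqI) (auto intro!: smooth_op_diff simp: op)
  show "a * b * c = a * (b * c)"
  proof transfer
    fix a b c :: "'a diffop"
    assume "smooth_op_eq a a" "smooth_op_eq b b" "smooth_op_eq c c"
    note [simp] = this[THEN op]
    show "smooth_op_eq (\<lambda>f. a (b (c f))) (\<lambda>f. a (b (c f)))"
      by (intro eqI smooth_op_compose[of a "\<lambda>f. b (c f)"] smooth_op_compose[of b c]) simp_all
  qed
  show "1 * a = a" "a * 1 = a"
    by (transfer, simp)+
  show "(a + b) * c = a * c + b * c"
  proof transfer
    fix a b c :: "'a diffop"
    assume "smooth_op_eq a a" "smooth_op_eq b b" "smooth_op_eq c c"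
    note [simp] = this[THEN op]
    show "smooth_op_eq (\<lambda>f y. a (c f) y + b (c f) y) (\<lambda>f y. a (c f) y + b (c f) y)"
      by (intro eqI smooth_op_add smooth_op_compose[of a c] smooth_op_compose[of b c]) simp_all
  qed
  show "a * (b + c) = a * b + a * c"
  proof transfer
    fix a b c :: "'a diffop"
    assume "smooth_op_eq a a" "smooth_op_eq b b" "smooth_op_eq c c"
    note [simp] = this[THEN op]
    show "smooth_op_eq (\<lambda>f. a (\<lambda>y. b f y + c f y)) (\<lambda>f y. a (b f) y + a (c f) y)"
      by (intro eqI smooth_op_compose[of a "\<lambda>f y. b f y + c f y"] smooth_op_add)
        (auto simp: smooth_op_additive smooth_op_smooth)
  qed
  show "r *\<^sub>R (a + b) = r *\<^sub>R a + r *\<^sub>R b"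
    by (transfer, rule eqI) (auto intro!: smooth_op_scaleR smooth_op_add simp: op algebra_simps)
  show "(r + s) *\<^sub>R a = r *\<^sub>R a + s *\<^sub>R a"
    by (transfer, rule eqI) (auto intro!: smooth_op_scaleR smooth_op_add simp: op algebra_simps)
  show "r *\<^sub>R s *\<^sub>R a = (r * s) *\<^sub>R a"
    by (transfer, rule eqI) (auto intro!: smooth_op_scaleR simp: op)
  show "1 *\<^sub>R a = a"
    by transfer simp
  show "r *\<^sub>R a * b = r *\<^sub>R (a * b)"
  proof transfer
    fix r and a b :: "'a diffop"
    assume "smooth_op_eq a a" "smooth_op_eq b b"
    note [simp] = this[THEN op]
    show "smooth_op_eq (\<lambda>f y. r *\<^sub>R a (b f) y) (\<lambda>f y. r *\<^sub>R a (b f) y)"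
      by (intro eqI smooth_op_scaleR smooth_op_compose[of a b]) simp_all
  qed
  show "a * r *\<^sub>R b = r *\<^sub>R (a * b)"
  proof transfer
    fix r and a b :: "'a diffop"
    assume "smooth_op_eq a a" "smooth_op_eq b b"
    note [simp] = this[THEN op]
    show "smooth_op_eq (\<lambda>f. a (\<lambda>y. r *\<^sub>R b f y)) (\<lambda>f y. r *\<^sub>R a (b f) y)"
      by (intro eqI smooth_op_compose[of a "\<lambda>f y. r *\<^sub>R b f y"] smooth_op_scaleR    )
        (auto simp: smooth_op_scale smooth_op_smooth scaleR_conv_of_real)
  qed
  show "(0 :: 'a operator) \<noteq> 1"
  proof (transfer, rule)
    assume eq: "smooth_op_eq (\<lambda>f y. 0) (\<lambda>f. f :: real ^ 'a \<Rightarrow> complex)"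
    have "(\<chi> i. 1) \<in> (regular_region :: (real ^ 'a) set)"
      by (simp add: regular_region_def)
    with eq smooth_const[of 1] show False
      unfolding smooth_op_eq_def op_eq_on_def by fastforce
  qed
qed

end

text \<open>
  Rules for \<open>represents\<close> build the ring element of a composite differential operator along its syntax,
  and \<open>represents_eq_iff\<close> moves equations between the ring and the regular region.
\<close>

definition represents :: "'n::finite operator \<Rightarrow> 'n diffop \<Rightarrow> bool" where
  "represents a A \<longleftrightarrow> smooth_op A \<and> abs_operator A = a"

lemma represents_eq_iff:
  "represents a A \<Longrightarrow> represents b B \<Longrightarrow> a = b \<longleftrightarrow> op_eq_on regular_region A B"
  using Quotient_rel[OF Quotient_operator, of A B]
  by (auto simp: represents_def smooth_op_eq_def op_eq_on_def)

lemma smooth_op_eq_refl: "smooth_op A \<Longrightarrow> smooth_op_eq A A"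
  by (simp add: smooth_op_eq_def op_eq_on_def)

lemma represents_abs: "smooth_op A \<Longrightarrow> represents (abs_operator A) A"
  by (simp add: represents_def)

lemma represents_one: "represents 1 (\<lambda>f. f)"
  by (simp add: represents_def smooth_op_id one_operator_def)

lemma represents_zero: "represents 0 (\<lambda>f y. 0)"
  by (simp add: represents_def smooth_op_zero zero_operator_def)

lemma represents_mult:
  "represents a A \<Longrightarrow> represents b B \<Longrightarrow> represents (a * b) (\<lambda>f. A (B f))"
  by (auto simp: represents_def smooth_op_compose times_operator.abs_eq smooth_op_eq_refl)

lemma represents_add:
  "represents a A \<Longrightarrow> represents b B \<Longrightarrow> represents (a + b) (\<lambda>f y. A f y + B f y)"
  by (auto simp: represents_def smooth_op_add plus_operator.abs_eq smooth_op_eq_refl)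

lemma represents_diff:
  "represents a A \<Longrightarrow> represents b B \<Longrightarrow> represents (a - b) (\<lambda>f y. A f y - B f y)"
  by (auto simp: represents_def smooth_op_diff minus_operator.abs_eq smooth_op_eq_refl)

lemma represents_uminus: "represents a A \<Longrightarrow> represents (- a) (\<lambda>f y. - A f y)"
  by (auto simp: represents_def smooth_op_uminus uminus_operator.abs_eq smooth_op_eq_refl)

lemma represents_scaleR: "represents a A \<Longrightarrow> represents (c *\<^sub>R a) (\<lambda>f y. c *\<^sub>R A f y)"
  by (auto simp: represents_def smooth_op_scaleR scaleR_operator.abs_eq smooth_op_eq_refl)

lemma represents_sum:
  "(\<And>k. k \<in> K \<Longrightarrow> represents (a k) (A k)) \<Longrightarrow> represents (\<Sum>k\<in>K. a k) (\<lambda>f y. \<Sum>k\<in>K. A k f y)"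
  by (induction K rule: infinite_finite_induct) (auto intro: represents_zero represents_add)

lemma represents_commutator:
  "represents a A \<Longrightarrow> represents b B \<Longrightarrow> represents (a * b - b * a) (commutator A B)"
  unfolding commutator_def[abs_def] by (intro represents_diff represents_mult)

section \<open>The differential operators as elements of the algebra\<close>

lemma smooth_op_partial: "smooth_op (partial i)"
proof (rule smooth_opI)
  show "partial i f y = partial i g y"
    if "\<And>y. y \<in> regular_region \<Longrightarrow> f y = g y" "y \<in> regular_region" for f g y
    using partial_cong[OF open_regular_region that(2)] that(1) by blast
  show "partial i (\<lambda>x. c * f x) y = c * partial i f y"
    if "smooth f" "y \<in> regular_region" for c f y
    using partial_mult[OF _ smooth_differentiable[OF that], of "\<lambda>_. c"] by (simp add: partial_const)
qed (simp_all add: smooth_partial partial_add smooth_differentiable)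

definition coord_op :: "'n \<Rightarrow> 'n::finite operator" where
  "coord_op i = abs_operator (\<lambda>f y. coord i y * f y)"

definition inv_coord_op :: "'n \<Rightarrow> 'n::finite operator" where
  "inv_coord_op i = abs_operator (\<lambda>f y. inverse (coord i y) * f y)"

definition partial_op :: "'n \<Rightarrow> 'n::finite operator" where
  "partial_op i = abs_operator (partial i)"

lemma represents_coord: "represents (coord_op i) (\<lambda>f y. coord i y * f y)"
  unfolding coord_op_def by (intro represents_abs smooth_op_mult smooth_coord)

lemma represents_inv_coord: "represents (inv_coord_op i) (\<lambda>f y. inverse (coord i y) * f y)"
  unfolding inv_coord_op_def by (intro represents_abs smooth_op_mult smooth_inverse_coord)

lemma represents_partial: "represents (partial_op i) (partial i)"
  unfolding partial_op_def by (intro represents_abs smooth_op_partial)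

interpretation weyl: weyl_algebra coord_op inv_coord_op partial_op
proof
  fix i j :: "'n::finite"
  note Y = represents_coord and V = represents_inv_coord and D = represents_partial
  show "coord_op i * coord_op j = coord_op j * coord_op i"
    unfolding represents_eq_iff[OF represents_mult[OF Y Y] represents_mult[OF Y Y]]
    by (simp add: op_eq_on_def)
  show "partial_op i * partial_op j = partial_op j * partial_op i"
    unfolding represents_eq_iff[OF represents_mult[OF D D] represents_mult[OF D D]]
    by (simp add: op_eq_on_def partial_commute)
  show "coord_op i * inv_coord_op i = 1"
    unfolding represents_eq_iff[OF represents_mult[OF Y V] represents_one]
    by (simp add: op_eq_on_def coord_nonzero)
  show "inv_coord_op i * coord_op i = 1"
    unfolding represents_eq_iff[OF represents_mult[OF V Y] represents_one]
    by (simp add: op_eq_on_def coord_nonzero)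
  \<comment> \<open>The right-hand side of the product rule, with the Kronecker delta as an operator.\<close>
  have "represents (if i = j then 1 else 0) (\<lambda>f y. if i = j then f y else 0)"
    by (simp add: represents_one represents_zero)
  note rep = represents_eq_iff[THEN iffD2, OF represents_mult[OF D Y]
      represents_add[OF represents_mult[OF Y D] this]]
  show "partial_op i * coord_op j = coord_op j * partial_op i + (if i = j then 1 else 0)"
    by (rule rep) (auto simp: op_eq_on_def partial_mult partial_coord smooth_differentiable
        smooth_differentiable[OF smooth_coord])
qed

lemma represents_Jplus: "represents (weyl.jp i) (Jplus i)"
proof -
  have "Jplus i = (\<lambda>f y. (1/2) *\<^sub>R (coord i y * (coord i y * f y)))"
    by (simp add: fun_eq_iff Jplus_def coord_def scaleR_conv_of_real power2_eq_square)
  then show ?thesis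
    unfolding weyl.jp_def by (simp only: represents_scaleR[OF represents_mult[OF represents_coord represents_coord]])
qed

lemma represents_Jminus: "represents (weyl.jm b i) (Jminus b i)"
proof -
  have "(b i / (y $ i)\<^sup>2) *\<^sub>R c = b i *\<^sub>R (inverse (coord i y) * (inverse (coord i y) * c))" for y c
    by (simp add: coord_def scaleR_conv_of_real power2_eq_square divide_inverse mult.assoc)
  then have "Jminus b i = (\<lambda>f y. (1/2) *\<^sub>R (partial i (partial i f) y
      + b i *\<^sub>R (inverse (coord i y) * (inverse (coord i y) * f y))))"
    by (simp add: fun_eq_iff Jminus_def)
  then show ?thesis
    unfolding weyl.jm_def by (simp only: represents_scaleR[OF represents_add[OF
        represents_mult[OF represents_partial represents_partial]
        represents_scaleR[OF represents_mult[OF represents_inv_coord represents_inv_coord]]]])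
qed

lemma represents_Jzero: "represents (weyl.jz i) (Jzero i)"
proof -
  have "Jzero i = (\<lambda>f y. (1/4) *\<^sub>R (2 *\<^sub>R (coord i y * partial i f y) + f y))"
    by (simp add: fun_eq_iff Jzero_def coord_def scaleR_conv_of_real)
  then show ?thesis
    unfolding weyl.jz_def by (simp only: represents_scaleR[OF represents_add[OF
        represents_scaleR[OF represents_mult[OF represents_coord represents_partial]] represents_one]])
qed

lemma represents_angular: "represents (weyl.rot i j) (angular i j)"
proof -
  have "angular i j = (\<lambda>f y. coord i y * partial j f y - coord j y * partial i f y)"
    by (simp add: fun_eq_iff angular_def coord_def scaleR_conv_of_real)
  then show ?thesis
    unfolding weyl.rot_def by (simp only: represents_diff[OF represents_mult[OF represents_coord represents_partial]
        represents_mult[OF represents_coord represents_partial]])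
qed

lemma represents_op_sum:
  "(\<And>k. represents (a k) (A k)) \<Longrightarrow> represents (sum a K) (op_sum A K)"
  unfolding op_sum_def[abs_def] by (rule represents_sum)

lemma represents_casimir: "represents (weyl.su11.casimir_element b K) (casimir b K)"
proof -
  note z = represents_op_sum[OF represents_Jzero, where K = K]
    and p = represents_op_sum[OF represents_Jplus, where K = K]
    and m = represents_op_sum[of "weyl.jm b" "Jminus b" K, OF represents_Jminus]
  show ?thesis
    unfolding casimir_def[abs_def] weyl.su11.casimir_element_def
    by (rule represents_diff[OF represents_diff[OF represents_mult[OF z z] z] represents_mult[OF p m]])
qed

lemma represents_smooth_op: "represents a A \<Longrightarrow> smooth_op A"
  by (simp add: represents_def)

lemma represents_preserves_smooth: "represents a A \<Longrightarrow> preserves_smooth A"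
  by (simp add: represents_def smooth_op_def)

lemma su11_realization_Js:
  fixes b :: "'n::finite \<Rightarrow> real"
  shows "su11_realization Jplus (Jminus b) Jzero"
  unfolding su11_realization_def
proof (intro conjI allI impI)
  fix i j :: 'n
  note J = represents_Jplus represents_Jminus represents_Jzero
  note iff = represents_eq_iff[THEN iffD1]
  show "preserves_smooth (Jplus i)" "preserves_smooth (Jminus b i)" "preserves_smooth (Jzero i)"
    by (rule J[THEN represents_preserves_smooth])+
  show "op_eq_on regular_region (commutator (Jzero i) (Jplus i)) (Jplus i)"
    by (rule iff[OF represents_commutator[OF J(3,1)] J(1) weyl.su11.zp])
  show "op_eq_on regular_region (commutator (Jzero i) (Jminus b i)) (\<lambda>f y. - Jminus b i f y)"
    by (rule iff[OF represents_commutator[OF J(3,2)] represents_uminus[OF J(2)] weyl.su11.zm])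
  have "op_eq_on regular_region (commutator (Jminus b i) (Jplus i)) (\<lambda>f y. Jzero i f y + Jzero i f y)"
    by (rule iff[OF represents_commutator[OF J(2,1)] represents_add[OF J(3) J(3)] weyl.su11.mp])
  then show "op_eq_on regular_region (commutator (Jminus b i) (Jplus i)) (\<lambda>f y. 2 * Jzero i f y)"
    by (simp add: op_eq_on_def)
  assume "i \<noteq> j"
  have rep: "\<exists>a \<in> {weyl.jp k, weyl.jm b k, weyl.jz k}. represents a A"
    if "A \<in> {Jplus k, Jminus b k, Jzero k}" for k and A :: "'n diffop"
    using that J(1)[of k] J(2)[of b k] J(3)[of k] by auto
  show "\<forall>A\<in>{Jplus i, Jminus b i, Jzero i}. \<forall>B\<in>{Jplus j, Jminus b j, Jzero j}.
      op_eq_on regular_region (commutator A B) (\<lambda>f y. 0)"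
  proof (intro ballI)
    fix A B :: "'n diffop"
    assume "A \<in> {Jplus i, Jminus b i, Jzero i}" "B \<in> {Jplus j, Jminus b j, Jzero j}"
    then obtain a c where ac: "a \<in> {weyl.jp i, weyl.jm b i, weyl.jz i}" "represents a A"
      "c \<in> {weyl.jp j, weyl.jm b j, weyl.jz j}" "represents c B"
      using rep[of A i] rep[of B j] by blast
    then have "a * c - c * a = 0"
      using weyl.su11.distinct_commute[OF \<open>i \<noteq> j\<close> ac(1,3)] by simp
    then show "op_eq_on regular_region (commutator A B) (\<lambda>f y. 0)"
      by (rule iff[OF represents_commutator[OF ac(2,4)] represents_zero])
  qed
qed

text \<open>
  The part of order zero of \<open>C\<^sub>K\<close>.
\<close>

definition potential :: "('n \<Rightarrow> real) \<Rightarrow> 'n set \<Rightarrow> real ^ 'n \<Rightarrow> real" where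
  "potential b K y = ((real (card K))\<^sup>2 - 4 * real (card K)) / 16
     - (\<Sum>i\<in>K. (y $ i)\<^sup>2) * (\<Sum>i\<in>K. b i / (y $ i)\<^sup>2) / 4"

text \<open>
  Here the sum runs over all ordered pairs, hence the factor \<open>1/8\<close> instead of \<open>1/4\<close>.
\<close>

lemma casimir_eq_angular:
  fixes b :: "'n::finite \<Rightarrow> real"
  shows "op_eq_on regular_region (casimir b K)
    (\<lambda>f y. (- 1/8) *\<^sub>R (\<Sum>i\<in>K. \<Sum>j\<in>K. angular i j (angular i j f) y) + potential b K y *\<^sub>R f y)"
proof -
  have w: "represents (\<Sum>i\<in>K. b i *\<^sub>R (inv_coord_op i * inv_coord_op i))
      (\<lambda>f y. (\<Sum>i\<in>K. b i *\<^sub>R (inverse (coord i y) * (inverse (coord i y) * f y))))"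
    by (intro represents_sum represents_scaleR represents_mult[OF represents_inv_coord represents_inv_coord])
  have r: "represents (\<Sum>i\<in>K. coord_op i * coord_op i) (\<lambda>f y. (\<Sum>i\<in>K. coord i y * (coord i y * f y)))"
    by (intro represents_sum represents_mult[OF represents_coord represents_coord])
  have l: "represents (\<Sum>i\<in>K. \<Sum>j\<in>K. weyl.rot i j * weyl.rot i j)
      (\<lambda>f y. \<Sum>i\<in>K. \<Sum>j\<in>K. angular i j (angular i j f) y)"
    by (intro represents_sum represents_mult[OF represents_angular represents_angular])
  note rhs = represents_add[OF represents_diff[OF represents_scaleR[OF l]
        represents_scaleR[OF represents_mult[OF r w]]] represents_scaleR[OF represents_one]]
  have W: "(\<Sum>i\<in>K. b i *\<^sub>R (inverse (coord i y) * (inverse (coord i y) * c)))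
      = complex_of_real (\<Sum>i\<in>K. b i / (y $ i)\<^sup>2) * c" for y c
    by (simp add: coord_def sum_distrib_right scaleR_conv_of_real power2_eq_square divide_inverse mult.assoc)
  have R: "(\<Sum>i\<in>K. coord i y * (coord i y * c)) = complex_of_real (\<Sum>i\<in>K. (y $ i)\<^sup>2) * c" for y c
    by (simp add: coord_def sum_distrib_right power2_eq_square mult.assoc)
  have pot: "potential b K y *\<^sub>R c = (((real (card K))\<^sup>2 - 4 * real (card K)) / 16) *\<^sub>R c - (1/4) *\<^sub>R
      (\<Sum>i\<in>K. coord i y * (coord i y *
        (\<Sum>i\<in>K. b i *\<^sub>R (inverse (coord i y) * (inverse (coord i y) * c)))))" for y c
    unfolding W R potential_def scaleR_diff_left
    by (simp add: scaleR_conv_of_real)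
  show ?thesis
    using represents_eq_iff[THEN iffD1, OF represents_casimir rhs weyl.casimir_element_eq[OF finite, of b K]]
    unfolding op_eq_on_def pot by (simp add: algebra_simps)
qed

lemma smooth_op_hamiltonian: "smooth_op (hamiltonian b)"
proof -
  have "(\<Sum>i\<in>UNIV. b i / (y $ i)\<^sup>2) *\<^sub>R c
      = (\<Sum>i\<in>UNIV. b i *\<^sub>R (inverse (coord i y) * (inverse (coord i y) * c)))" for y c
    by (simp add: coord_def scaleR_conv_of_real sum_distrib_right power2_eq_square divide_inverse mult.assoc)
  then have eq: "hamiltonian b = (\<lambda>f y. (\<Sum>i\<in>UNIV. \<Sum>j\<in>{i<..}. angular i j (angular i j f) y)
      + (\<Sum>i\<in>UNIV. b i *\<^sub>R (inverse (coord i y) * (inverse (coord i y) * f y))))"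
    by (simp add: fun_eq_iff hamiltonian_def laplace_beltrami_def)
  have 1: "represents (\<Sum>i\<in>UNIV. \<Sum>j\<in>{i<..}. weyl.rot i j * weyl.rot i j)
      (\<lambda>f y. \<Sum>i\<in>UNIV. \<Sum>j\<in>{i<..}. angular i j (angular i j f) y)"
    by (intro represents_sum represents_mult[OF represents_angular represents_angular])
  have 2: "represents (\<Sum>i\<in>UNIV. b i *\<^sub>R (inv_coord_op i * inv_coord_op i))
      (\<lambda>f y. (\<Sum>i\<in>UNIV. b i *\<^sub>R (inverse (coord i y) * (inverse (coord i y) * f y))))"
    by (intro represents_sum represents_scaleR represents_mult[OF represents_inv_coord represents_inv_coord])
  show ?thesis
    unfolding eq by (rule represents_smooth_op[OF represents_add[OF 1 2]])
qed

section \<open>Restriction to the sphere\<close>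

text \<open>
  The function \<open>f (z / \<bar>z\<bar>)\<close> vanishes on the whole regular region, so its derivative at \<open>y\<close> is zero; and
  the radial projection has the identity as its derivative on vectors orthogonal to the unit vector \<open>y\<close>.
\<close>

lemma tangential_derivative_zero:
  assumes f: "smooth f" and zero: "\<And>x. x \<in> regular_sphere \<Longrightarrow> f x = 0"
    and y: "y \<in> regular_sphere" and v: "v \<bullet> y = 0"
  shows "frechet_derivative f (at y) v = 0"
proof -
  have y1: "norm y = 1" and yR: "y \<in> regular_region"
    using y by (auto simp: regular_sphere_def)
  \<comment> \<open>The radial projection onto the sphere.\<close>
  define r where "r z = inverse (norm z) *\<^sub>R z" for z :: "real ^ 'a"
  have ry: "r y = y"
    by (simp add: r_def y1)
  have "(norm has_derivative (\<lambda>h. h \<bullet> sgn y)) (at y)"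
    using y1 by (intro has_derivative_norm) auto
  then have "(r has_derivative (\<lambda>h. inverse (norm y) *\<^sub>R h
      + (- (inverse (norm y) * (h \<bullet> sgn y) * inverse (norm y))) *\<^sub>R y)) (at y)"
    unfolding r_def using y1
    by (intro has_derivative_scaleR Deriv.has_derivative_inverse has_derivative_ident) auto
  then have "(r has_derivative (\<lambda>h. h - (h \<bullet> y) *\<^sub>R y)) (at y)"
    by (simp add: y1 sgn_div_norm)
  from diff_chain_at[OF this] smooth_has_derivative[OF f yR]
  have "((\<lambda>z. f (r z)) has_derivative (\<lambda>h. frechet_derivative f (at y) (h - (h \<bullet> y) *\<^sub>R y))) (at y)"
    by (simp add: ry o_def)
  moreover have "((\<lambda>z. f (r z)) has_derivative (\<lambda>h. 0)) (at y)"
  proof (rule has_derivative_transform_within_open[OF has_derivative_const open_regular_region yR])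
    fix z :: "real ^ 'a" assume "z \<in> regular_region"
    moreover from this have "z \<noteq> 0"
      by (auto simp: regular_region_def)
    ultimately have "r z \<in> regular_sphere"
      by (auto simp: regular_sphere_def regular_region_def r_def)
    then show "0 = f (r z)"
      by (simp add: zero)
  qed
  ultimately have "(\<lambda>h. frechet_derivative f (at y) (h - (h \<bullet> y) *\<^sub>R y)) = (\<lambda>h. 0)"
    by (rule has_derivative_unique)
  from fun_cong[OF this, of v] show ?thesis
    by (simp add: v)
qed

text \<open>
  At \<open>y\<close> the operator differentiates in the direction \<open>y\<^sub>i e\<^sub>j - y\<^sub>j e\<^sub>i\<close>, which is orthogonal to \<open>y\<close>.
\<close>

lemma angular_sphere_cong:
  assumes f: "smooth f" and g: "smooth g" and eq: "\<And>x. x \<in> regular_sphere \<Longrightarrow> f x = g x"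
    and y: "y \<in> regular_sphere"
  shows "angular i j f y = angular i j g y"
proof -
  have yR: "y \<in> regular_region"
    using y by (simp add: regular_sphere_def)
  define h where "h x = f x + (-1) * g x" for x
  have h: "smooth h"
    unfolding h_def by (intro smooth_add smooth_mult smooth_const f g)
  interpret d: bounded_linear "frechet_derivative h (at y)"
    using smooth_has_derivative[OF h yR] by (rule has_derivative_bounded_linear)
  have "angular i j h y = frechet_derivative h (at y) (y $ i *\<^sub>R axis j 1 - y $ j *\<^sub>R axis i 1)"
    by (simp add: angular_def partial_def d.diff d.scaleR)
  also have "\<dots> = 0"
    by (rule tangential_derivative_zero[OF h _ y]) (simp_all add: h_def eq inner_diff_left inner_axis')
  finally have "angular i j h y = 0" .
  moreover have "angular i j h y = angular i j f y + (-1) * angular i j g y"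
    unfolding h_def
    by (simp only: smooth_op_additive[OF represents_smooth_op[OF represents_angular] f _ yR]
        smooth_op_scale[OF represents_smooth_op[OF represents_angular] g yR]
        smooth_mult[OF smooth_const g])
  ultimately show ?thesis
    by simp
qed

lemma angular_square_sphere_cong:
  assumes "smooth f" "smooth g" "\<And>x. x \<in> regular_sphere \<Longrightarrow> f x = g x" "y \<in> regular_sphere"
  shows "angular i j (angular i j f) y = angular i j (angular i j g) y"
  using assms by (intro angular_sphere_cong smooth_op_smooth[OF represents_smooth_op[OF represents_angular]])

lemma restricts_to_sphereI:
  assumes "\<And>f. smooth f \<Longrightarrow> smooth (A f)"
    and "\<And>f g y. \<lbrakk>smooth f; smooth g; \<And>x. x \<in> regular_sphere \<Longrightarrow> f x = g x; y \<in> regular_sphere\<rbrakk>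
      \<Longrightarrow> A f y = A g y"
  shows "restricts_to_sphere A"
  unfolding restricts_to_sphere_def preserves_smooth_def using assms by blast

lemma restricts_to_sphere_cong:
  "\<lbrakk>restricts_to_sphere A; smooth f; smooth g; \<And>x. x \<in> regular_sphere \<Longrightarrow> f x = g x;
    y \<in> regular_sphere\<rbrakk> \<Longrightarrow> A f y = A g y"
  unfolding restricts_to_sphere_def by blast

lemma restricts_to_sphere_smooth: "restricts_to_sphere A \<Longrightarrow> smooth f \<Longrightarrow> smooth (A f)"
  by (simp add: restricts_to_sphere_def preserves_smooth_def)

lemma casimir_restricts:
  fixes b :: "'n::finite \<Rightarrow> real"
  shows "restricts_to_sphere (casimir b K)"
  unfolding restricts_to_sphere_def
proof (intro conjI allI impI ballI)
  show "preserves_smooth (casimir b K)"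
    using represents_casimir by (rule represents_preserves_smooth)
  fix f g :: "real ^ 'n \<Rightarrow> complex" and y :: "real ^ 'n"
  assume fg: "smooth f" "smooth g" "\<forall>y\<in>regular_sphere. f y = g y" and y: "y \<in> regular_sphere"
  then have "angular i j (angular i j f) y = angular i j (angular i j g) y" for i j
    by (intro angular_square_sphere_cong) auto
  with fg y casimir_eq_angular[of b K] show "casimir b K f y = casimir b K g y"
    by (simp add: op_eq_on_def regular_sphere_def)
qed

lemma hamiltonian_restricts:
  fixes b :: "'n::{finite,linorder} \<Rightarrow> real"
  shows "restricts_to_sphere (hamiltonian b)"
  unfolding restricts_to_sphere_def
proof (intro conjI allI impI ballI)
  show "preserves_smooth (hamiltonian b)"
    using smooth_op_hamiltonian unfolding smooth_op_def by blast
  fix f g :: "(real, 'n) vec \<Rightarrow> complex" and y :: "(real, 'n) vec"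
  assume fg: "smooth f" "smooth g" "\<forall>y\<in>regular_sphere. f y = g y" and y: "y \<in> regular_sphere"
  then have "angular i j (angular i j f) y = angular i j (angular i j g) y" for i j
    by (intro angular_square_sphere_cong) auto
  with fg y show "hamiltonian b f y = hamiltonian b g y"
    by (simp add: hamiltonian_def laplace_beltrami_def)
qed

lemma sum_symmetric_matrix:
  fixes g :: "'n::{finite,linorder} \<Rightarrow> 'n \<Rightarrow> complex"
  assumes "\<And>i j. g i j = g j i" "\<And>i. g i i = 0"
  shows "(\<Sum>i\<in>UNIV. \<Sum>j\<in>UNIV. g i j) = 2 * (\<Sum>i\<in>UNIV. \<Sum>j\<in>{i<..}. g i j)"
proof -
  define u where "u i j = (if i < j then g i j else 0)" for i j
  have "g i j = u i j + u j i" for i j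
    using assms(1)[of i j] assms(2)[of j] by (auto simp: u_def)
  then have "(\<Sum>i\<in>UNIV. \<Sum>j\<in>UNIV. g i j) = (\<Sum>i\<in>UNIV. \<Sum>j\<in>UNIV. u i j) + (\<Sum>i\<in>UNIV. \<Sum>j\<in>UNIV. u j i)"
    by (simp only: sum.distrib)
  also have "\<dots> = 2 * (\<Sum>i\<in>UNIV. \<Sum>j\<in>UNIV. u i j)"
    using sum.swap[of u UNIV UNIV] by simp
  also have "(\<lambda>i. \<Sum>j\<in>UNIV. u i j) = (\<lambda>i. \<Sum>j\<in>{i<..}. g i j)"
    unfolding u_def by (simp add: sum.If_cases greaterThan_def)
  finally show ?thesis .
qed

text \<open>
  The sum over all pairs counts each \<open>i < j\<close> twice, since the squares do not change under \<open>i \<longleftrightarrow> j\<close>.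
\<close>

lemma laplace_beltrami_eq:
  fixes f :: "(real, 'n::{finite,linorder}) vec \<Rightarrow> complex"
  assumes "smooth f" "y \<in> regular_region"
  shows "(\<Sum>i\<in>UNIV. \<Sum>j\<in>UNIV. angular i j (angular i j f) y) = 2 * laplace_beltrami f y"
  unfolding laplace_beltrami_def
proof (rule sum_symmetric_matrix)
  fix i j :: 'n
  have "weyl.rot i j * weyl.rot i j = weyl.rot j i * weyl.rot j i"
    by (simp add: weyl.rot_def algebra_simps)
  then have "op_eq_on regular_region (\<lambda>f. angular i j (angular i j f)) (\<lambda>f. angular j i (angular j i f))"
    by (rule represents_eq_iff[THEN iffD1, OF represents_mult[OF represents_angular represents_angular]
          represents_mult[OF represents_angular represents_angular]])
  then show "angular i j (angular i j f) y = angular j i (angular j i f) y"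
    using assms by (simp add: op_eq_on_def)
  show "angular i i (angular i i f) y = 0"
    by (simp add: angular_def)
qed

lemma casimir_eq_hamiltonian:
  fixes b :: "'n::{finite,linorder} \<Rightarrow> real"
  shows "op_eq_on regular_sphere (casimir b UNIV)
    (\<lambda>f y. (- 1/4) *\<^sub>R hamiltonian b f y
       + (((real CARD('n))\<^sup>2 - 4 * real CARD('n)) / 16) *\<^sub>R f y)"
  unfolding op_eq_on_def
proof (intro allI impI ballI)
  fix f :: "(real, 'n) vec \<Rightarrow> complex" and y :: "(real, 'n) vec"
  assume f: "smooth f" and y: "y \<in> regular_sphere"
  then have yR: "y \<in> regular_region" and "norm y = 1"
    by (simp_all add: regular_sphere_def)
  then have "(\<Sum>i\<in>UNIV. (y $ i)\<^sup>2) = 1"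
    by (simp add: norm_vec_def L2_set_def)
  moreover define w where "w = (\<Sum>i\<in>UNIV. b i / (y $ i)\<^sup>2)"
  ultimately have pot: "potential b UNIV y = ((real CARD('n))\<^sup>2 - 4 * real CARD('n)) / 16 - w / 4"
    by (simp add: potential_def)
  have "casimir b UNIV f y = (- 1/8) *\<^sub>R (2 * laplace_beltrami f y) + potential b UNIV y *\<^sub>R f y"
    using casimir_eq_angular[of b UNIV] f yR by (simp add: op_eq_on_def laplace_beltrami_eq)
  also have "\<dots> = (- 1/4) *\<^sub>R hamiltonian b f y
       + (((real CARD('n))\<^sup>2 - 4 * real CARD('n)) / 16) *\<^sub>R f y"
    unfolding pot hamiltonian_def w_def[symmetric]
    by (simp add: scaleR_conv_of_real field_simps)
  finally show "casimir b UNIV f y = (- 1/4) *\<^sub>R hamiltonian b f y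
       + (((real CARD('n))\<^sup>2 - 4 * real CARD('n)) / 16) *\<^sub>R f y" .
qed

section \<open>Symmetries of the Hamiltonian\<close>

lemma casimir_commute:
  "op_eq_on regular_region (\<lambda>f. casimir b K (casimir b UNIV f)) (\<lambda>f. casimir b UNIV (casimir b K f))"
  by (rule represents_eq_iff[THEN iffD1, OF represents_mult[OF represents_casimir represents_casimir]
        represents_mult[OF represents_casimir represents_casimir] weyl.su11.casimir_element_commute[OF finite subset_UNIV]])

text \<open>
  On the sphere \<open>H = - 4 C\<^bsub>[n]\<^esub> + c\<close> when applied to any smooth function. This is used for \<open>f\<close>, under
  \<open>C\<^sub>K\<close>, where it is legitimate since \<open>C\<^sub>K\<close> depends only on values on the sphere, and for \<open>C\<^sub>K f\<close>.
\<close>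

lemma casimir_commute_hamiltonian:
  fixes b :: "'n::{finite,linorder} \<Rightarrow> real"
  shows "op_eq_on regular_sphere (casimir b K \<circ> hamiltonian b) (hamiltonian b \<circ> casimir b K)"
  unfolding op_eq_on_def o_def
proof (intro allI impI ballI)
  fix f :: "(real, 'n) vec \<Rightarrow> complex" and y :: "(real, 'n) vec"
  assume f: "smooth f" and y: "y \<in> regular_sphere"
  then have yR: "y \<in> regular_region"
    by (simp add: regular_sphere_def)
  define c where "c = (of_real (((real CARD('n))\<^sup>2 - 4 * real CARD('n)) / 4) :: complex)"
  have H: "hamiltonian b g x = (-4) * casimir b UNIV g x + c * g x"
    if "smooth g" "x \<in> regular_sphere" for g x
    using casimir_eq_hamiltonian[of b] that
    by (simp add: op_eq_on_def c_def scaleR_conv_of_real algebra_simps)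
  have C: "smooth_op (casimir b L)" for L
    using represents_casimir by (rule represents_smooth_op)
  note sm = smooth_op_smooth[OF C] smooth_op_smooth[OF smooth_op_hamiltonian]
    smooth_add smooth_mult smooth_const f
  have "casimir b K (hamiltonian b f) y = casimir b K (\<lambda>x. (-4) * casimir b UNIV f x + c * f x) y"
    by (rule restricts_to_sphere_cong[OF casimir_restricts _ _ H[OF f] y]) (intro sm)+
  also have "\<dots> = (-4) * casimir b K (casimir b UNIV f) y + c * casimir b K f y"
    by (simp only: smooth_op_additive[OF C _ _ yR] smooth_op_scale[OF C _ yR] sm)
  also have "casimir b K (casimir b UNIV f) y = casimir b UNIV (casimir b K f) y"
    using casimir_commute[of b K] f yR by (simp add: op_eq_on_def)
  also have "(-4) * \<dots> + c * casimir b K f y = hamiltonian b (casimir b K f) y"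
    by (simp add: H y sm)
  finally show "casimir b K (hamiltonian b f) y = hamiltonian b (casimir b K f) y" .
qed

lemma racah_algebra_restricts: "A \<in> racah_algebra b \<Longrightarrow> restricts_to_sphere A"
proof (induction rule: racah_algebra.induct)
  case (gen K)
  show ?case
    by (rule casimir_restricts)
next
  case (mult A B)
  note sm = mult.IH[THEN restricts_to_sphere_smooth]
  show ?case
    unfolding o_def
  proof (rule restricts_to_sphereI)
    show "smooth (A (B f))" if "smooth f" for f
      by (intro sm that)
    show "A (B f) y = A (B g) y"
      if "smooth f" "smooth g" "\<And>x. x \<in> regular_sphere \<Longrightarrow> f x = g x" "y \<in> regular_sphere" for f g y
      by (rule restricts_to_sphere_cong[OF mult.IH(1) sm(2)[OF that(1)] sm(2)[OF that(2)]
            restricts_to_sphere_cong[OF mult.IH(2) that(1-3)] that(4)])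
  qed
next
  case (add A B)
  note sm = add.IH[THEN restricts_to_sphere_smooth]
  show ?case
  proof (rule restricts_to_sphereI)
    show "smooth (\<lambda>y. A f y + B f y)" if "smooth f" for f
      by (intro smooth_add sm that)
    show "A f y + B f y = A g y + B g y"
      if "smooth f" "smooth g" "\<And>x. x \<in> regular_sphere \<Longrightarrow> f x = g x" "y \<in> regular_sphere" for f g y
      by (intro arg_cong2[where f = "(+)"] restricts_to_sphere_cong[OF add.IH(1) that]
          restricts_to_sphere_cong[OF add.IH(2) that])
  qed
next
  case (scale A c)
  note sm = scale.IH[THEN restricts_to_sphere_smooth]
  show ?case
  proof (rule restricts_to_sphereI)
    show "smooth (\<lambda>y. c * A f y)" if "smooth f" for f
      by (intro smooth_mult smooth_const sm that)
    show "c * A f y = c * A g y"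
      if "smooth f" "smooth g" "\<And>x. x \<in> regular_sphere \<Longrightarrow> f x = g x" "y \<in> regular_sphere" for f g y
      by (rule arg_cong[OF restricts_to_sphere_cong[OF scale.IH that]])
  qed
qed (rule restricts_to_sphereI, simp_all)

text \<open>
  For a product \<open>A \<circ> B\<close> the equation for \<open>B\<close> holds only on the sphere, so applying \<open>A\<close> to it needs that
  \<open>A\<close> restricts to the sphere.
\<close>

lemma racah_algebra_commute_hamiltonian:
  fixes b :: "'n::{finite,linorder} \<Rightarrow> real"
  assumes "A \<in> racah_algebra b"
  shows "op_eq_on regular_sphere (A \<circ> hamiltonian b) (hamiltonian b \<circ> A)"
  using assms
proof (induction rule: racah_algebra.induct)
  case one
  show ?case
    by (simp add: op_eq_on_def)
next
  case (gen K)
  show ?case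
    by (rule casimir_commute_hamiltonian)
next
  case (scale A c)
  then show ?case
    using smooth_op_scale[OF smooth_op_hamiltonian
        restricts_to_sphere_smooth[OF racah_algebra_restricts[OF scale.hyps(1)]]]
    by (simp add: op_eq_on_def regular_sphere_def)
next
  case (add A B)
  then show ?case
    using smooth_op_additive[OF smooth_op_hamiltonian
        add.hyps[THEN racah_algebra_restricts, THEN restricts_to_sphere_smooth]]
    by (simp add: op_eq_on_def regular_sphere_def)
next
  case (mult A B)
  note AB = mult.hyps[THEN racah_algebra_restricts]
  show ?case
    unfolding op_eq_on_def o_def
  proof (intro allI impI ballI)
    fix f :: "(real, 'n) vec \<Rightarrow> complex" and y :: "(real, 'n) vec"
    assume f: "smooth f" and y: "y \<in> regular_sphere"
    note sm = restricts_to_sphere_smooth[OF AB(2)]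
      restricts_to_sphere_smooth[OF hamiltonian_restricts] f
    have "A (B (hamiltonian b f)) y = A (hamiltonian b (B f)) y"
      using mult.IH(2) f by (intro restricts_to_sphere_cong[OF AB(1) _ _ _ y] sm) (simp add: op_eq_on_def)
    also have "\<dots> = hamiltonian b (A (B f)) y"
      using mult.IH(1) sm y by (simp add: op_eq_on_def)
    finally show "A (B (hamiltonian b f)) y = hamiltonian b (A (B f)) y" .
  qed
qed

theorem mainTheorem1:
  fixes b :: "'n::{finite,linorder} \<Rightarrow> real"
  assumes "CARD('n) \<ge> 3"
  shows "su11_realization Jplus (Jminus b) Jzero
    \<and> restricts_to_sphere (hamiltonian b)
    \<and> (\<forall>A\<in>racah_algebra b. restricts_to_sphere A)
    \<and> op_eq_on regular_sphere (casimir b UNIV)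
        (\<lambda>f y. (- 1/4) *\<^sub>R hamiltonian b f y
           + (((real CARD('n))\<^sup>2 - 4 * real CARD('n)) / 16) *\<^sub>R f y)
    \<and> (\<forall>K. K \<noteq> {} \<longrightarrow>
        op_eq_on regular_sphere (casimir b K \<circ> hamiltonian b) (hamiltonian b \<circ> casimir b K))
    \<and> (\<forall>A\<in>racah_algebra b.
        op_eq_on regular_sphere (A \<circ> hamiltonian b) (hamiltonian b \<circ> A))"
  by (intro conjI ballI allI impI su11_realization_Js hamiltonian_restricts racah_algebra_restricts
      casimir_eq_hamiltonian casimir_commute_hamiltonian racah_algebra_commute_hamiltonian)

end
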